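(* Let $G$ be a finite simple connected vertex-transitive non-bipartite graph of degree $k$ (i.e. $k$-regular) and of even order $|V(G)|\ge 6$. Then $G$ is $4$-factor-critical if and only if $k\ge 5$.
   Context: A graph $G$ is vertex-transitive if for any two vertices $x,y$ there is an automorphism $\varphi$ of $G$ with $\varphi(x)=y$. A perfect matching is a set of pairwise nonadjacent edges covering all vertices (the graph with no vertices is regarded as having a perfect matching). A graph of order $n$ is $p$-factor-critical, where $p$ is an integer of the same parity as $n$, if the removal of any set of $p$ vertices results in a graph with a perfect matching. *)

theory Defs
  imports "Graph_Theory.Graph_Theory" "HOL-Library.Disjoint_Sets"
begin

text \<open>
  Finite simple graphs are the symmetric loop-free digraphs without parallel arcs of the locale
  \<^locale>\<open>graph\<close>. An undirected edge is a pair of opposite arcs; where edges are counted or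
  chosen individually, as in a matching, it is represented by the set of its two end vertices.
\<close>

definition edges :: "('a, 'b) pre_digraph \<Rightarrow> 'a set set" where
  "edges G = {{u, v} | u v. (u, v) \<in> arcs_ends G}"

text \<open>In a symmetric digraph the out-degree of a vertex is its degree.\<close>

definition regular_graph :: "nat \<Rightarrow> ('a, 'b) pre_digraph \<Rightarrow> bool" where
  "regular_graph k G \<longleftrightarrow> (\<forall>v \<in> verts G. out_degree G v = k)"

definition bipartite_graph :: "('a, 'b) pre_digraph \<Rightarrow> bool" where
  "bipartite_graph G \<longleftrightarrow>
     (\<exists>U W. verts G = U \<union> W \<and> U \<inter> W = {} \<and> arcs_ends G \<subseteq> U \<times> W \<union> W \<times> U)"

text \<open>
  An isomorphism also acts on arcs. In a graph its arc part is determined by its vertex part, as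
  \<open>automorphism_on_verts_iff\<close> below shows.
\<close>

definition automorphism :: "('a, 'b) pre_digraph \<Rightarrow> ('a, 'b, 'a, 'b) digraph_isomorphism \<Rightarrow> bool" where
  "automorphism G h \<longleftrightarrow> pre_digraph.digraph_isomorphism G h \<and> app_iso h G = G"

definition vertex_transitive :: "('a, 'b) pre_digraph \<Rightarrow> bool" where
  "vertex_transitive G \<longleftrightarrow>
     (\<forall>x \<in> verts G. \<forall>y \<in> verts G. \<exists>h. automorphism G h \<and> iso_verts h x = y)"

definition perfect_matching :: "('a, 'b) pre_digraph \<Rightarrow> 'a set set \<Rightarrow> bool" where
  "perfect_matching G M \<longleftrightarrow> M \<subseteq> edges G \<and> disjoint M \<and> \<Union>M = verts G"

definition factor_critical :: "nat \<Rightarrow> ('a, 'b) pre_digraph \<Rightarrow> bool" where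
  "factor_critical p G \<longleftrightarrow>
     even p = even (card (verts G)) \<and>
     (\<forall>S \<subseteq> verts G. card S = p \<longrightarrow> (\<exists>M. perfect_matching (G \<restriction> (verts G - S)) M))"

lemma automorphism_on_verts_iff:
  assumes "Digraph.graph G"
  shows "(\<exists>h. automorphism G h \<and> iso_verts h = f) \<longleftrightarrow>
    bij_betw f (verts G) (verts G) \<and>
    (\<forall>u \<in> verts G. \<forall>v \<in> verts G. (f u, f v) \<in> arcs_ends G \<longleftrightarrow> (u, v) \<in> arcs_ends G)"
    (is "?L \<longleftrightarrow> ?R")
proof
  interpret graph G by fact
  assume ?L
  then obtain h where h: "digraph_isomorphism h" "app_iso h G = G" "iso_verts h = f"
    by (auto simp: automorphism_def)
  have V: "f ` verts G = verts G" and A: "iso_arcs h ` arcs G = arcs G"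
    and T: "iso_tail h = tail G" and H: "iso_head h = head G"
    using h(3) arg_cong[OF h(2), of verts] arg_cong[OF h(2), of arcs]
      arg_cong[OF h(2), of tail] arg_cong[OF h(2), of head] by auto
  have inj: "inj_on f (verts G)"
    and e: "\<And>a. a \<in> arcs G \<Longrightarrow>
      tail G (iso_arcs h a) = f (tail G a) \<and> head G (iso_arcs h a) = f (head G a)"
    using h(1,3) T H by (auto simp: digraph_isomorphism_def)
  have "(f u, f v) \<in> arcs_ends G \<longleftrightarrow> (u, v) \<in> arcs_ends G"
    if uv: "u \<in> verts G" "v \<in> verts G" for u v
  proof
    assume "(f u, f v) \<in> arcs_ends G"
    then obtain b where b: "b \<in> arcs G" "tail G b = f u" "head G b = f v" by auto
    then obtain a where a: "a \<in> arcs G" "b = iso_arcs h a"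
      using A by blast
    then have "f (tail G a) = f u" "f (head G a) = f v"
      using b e[of a] by simp_all
    then have "tail G a = u" "head G a = v"
      using inj uv a(1) by (meson inj_onD tail_in_verts head_in_verts)+
    then show "(u, v) \<in> arcs_ends G"
      using a(1) by (auto simp: arcs_ends_conv)
  next
    assume "(u, v) \<in> arcs_ends G"
    then obtain a where a: "a \<in> arcs G" "tail G a = u" "head G a = v" by auto
    then have "iso_arcs h a \<in> arcs G"
      using A by blast
    then show "(f u, f v) \<in> arcs_ends G"
      using a e[of a] by (force simp: arcs_ends_conv)
  qed
  then show ?R using inj V by (simp add: bij_betw_def)
next
  interpret graph G by fact
  assume R: ?R
  define g where "g a = (THE b. b \<in> arcs G \<and> arc_to_ends G b = (f (tail G a), f (head G a)))" for a
  have g: "g a \<in> arcs G \<and> arc_to_ends G (g a) = (f (tail G a), f (head G a))"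
    if "a \<in> arcs G" for a
  proof -
    have "(f (tail G a), f (head G a)) \<in> arcs_ends G"
      using R that by (auto simp: arcs_ends_conv)
    then have "\<exists>b. b \<in> arcs G \<and> arc_to_ends G b = (f (tail G a), f (head G a))"
      by (auto simp: arcs_ends_def)
    then have "\<exists>!b. b \<in> arcs G \<and> arc_to_ends G b = (f (tail G a), f (head G a))"
      by (auto intro!: no_multi_arcs)
    from theI'[OF this] show ?thesis by (simp add: g_def)
  qed
  have inj: "inj_on f (verts G)" and V: "f ` verts G = verts G"
    using R by (auto simp: bij_betw_def)
  have injg: "inj_on g (arcs G)"
  proof (rule inj_onI)
    fix a b assume a: "a \<in> arcs G" "b \<in> arcs G" "g a = g b"
    then have "f (tail G a) = f (tail G b)" "f (head G a) = f (head G b)"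
      using g[of a] g[of b] by simp_all
    then have "tail G a = tail G b" "head G a = head G b"
      using a inj by (meson inj_onD tail_in_verts head_in_verts)+
    then show "a = b"
      using a by (intro no_multi_arcs) (simp_all add: arc_to_ends_def)
  qed
  have A: "g ` arcs G = arcs G"
    using g injg by (intro card_subset_eq finite_arcs) (auto simp: card_image)
  define h where "h = \<lparr>iso_verts = f, iso_arcs = g, iso_head = head G, iso_tail = tail G\<rparr>"
  have "digraph_isomorphism h"
    using g inj injg wf_digraph by (auto simp: h_def digraph_isomorphism_def arc_to_ends_def)
  moreover have "app_iso h G = G"
    by (rule pre_digraph.equality) (use V A in \<open>auto simp: h_def\<close>)
  ultimately show ?L
    unfolding automorphism_def by (intro exI[of _ h]) (simp add: h_def)
qed

end

theory Submission
  imports Defs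
begin

text \<open>
  Suppose that removing some four vertices leaves no perfect matching. By Tutte's theorem there are
  a vertex set \<open>X\<close> and a family \<open>F\<close> of at least \<open>card X - 2\<close> disjoint odd sets all of whose outer
  neighbours lie in \<open>X\<close>. Let \<open>p\<close> be the number of non-singletons in \<open>F\<close>. Uncrossing small edge cuts
  shows that each of them sends at least \<open>2k - 2\<close> edges to \<open>X\<close>, so counting edges at \<open>X\<close> gives
  \<open>(k - 2) p \<le> 2k\<close>. On the other hand the singletons form a set \<open>S\<close> with \<open>|N(S)| \<le> |S| + p + 2\<close>,
  whereas \<open>|N(S)| - |S|\<close> is submodular and its atoms are blocks of imprimitivity, which forces
  \<open>|N(S)| \<ge> |S| + 4\<close>. Hence \<open>p \<ge> 2\<close>, and \<open>p \<ge> 3\<close> if \<open>k \<ge> 6\<close> by the parity of the atoms. Only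
  \<open>k = 5\<close> and \<open>k = 6\<close> survive, with almost no slack: the same argument for closed neighbourhoods
  produces singletons in \<open>F\<close>, these limit the triangles, and triangle-free graphs have larger cuts.
\<close>

section \<open>Tutte's theorem\<close>

text \<open>Four vertices of \<open>X\<close> are the removed ones, the others a Tutte set; even
  order raises the surplus of odd sets from one to two, whence \<open>card X - 2\<close>. The bound
  \<open>2k - 2\<close> is the cut of a single edge, and 4 is the least excess that divisibility
  leaves: the least excess is a multiple \<open>d * a\<close> of the size \<open>a\<close> of an
  atom, with \<open>k \<le> (d + 1) * a\<close>, where \<open>d = 0\<close> means bipartite and
  \<open>d = 1\<close> makes \<open>a\<close> even. Triangles matter because a singleton
  \<open>{v}\<close> in the family has its whole neighbourhood in \<open>X\<close>: a triangle at
  \<open>v\<close> puts an edge inside \<open>X\<close>, and such edges count against the degree sum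
  of \<open>X\<close>. In the end \<open>k = 6\<close> affords no edge inside \<open>X\<close>, and
  \<open>k = 5\<close> at most one. What resists counting is \<open>k = 5\<close> with
  \<open>X\<close> the neighbourhood of \<open>v\<close> and two non-singletons, whose cuts are at
  least 9 and sum to at most 20. The largest connected set that avoids a neighbourhood serves only
  to raise one of these two cuts to 12.\<close>

lemma hall_marriage:
  assumes "finite I" "\<And>i. i \<in> I \<Longrightarrow> finite (N i)"
    and "\<And>J. J \<subseteq> I \<Longrightarrow> card J \<le> card (\<Union> (N ` J))"
  shows "\<exists>f. inj_on f I \<and> (\<forall>i \<in> I. f i \<in> N i)"
  using assms
proof (induction "card I" arbitrary: I N rule: less_induct)
  case less
  note fin = less.prems(1,2) and hall = less.prems(3)
  \<comment> \<open>A tight proper subfamily is matched on its own, and its union \<open>U\<close>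
    is deleted from the other sets. Without one, every nonempty proper subfamily has a spare
    element, so any choice for one index may be removed from the others.\<close>
  show ?case
  proof (cases "\<exists>J \<subset> I. J \<noteq> {} \<and> card (\<Union> (N ` J)) \<le> card J")
    case True
    then obtain J where J: "J \<subset> I" "J \<noteq> {}" "card (\<Union> (N ` J)) \<le> card J" by blast
    define U where "U = \<Union> (N ` J)"
    have finJ: "finite J" using J fin finite_subset[of J I] by auto
    have "card J < card I" using J fin by (simp add: psubset_card_mono)
    then obtain f where f: "inj_on f J" "\<forall>i \<in> J. f i \<in> N i"
      using less.hyps[of J N] fin finJ hall J(1) by (metis psubset_imp_subset subset_iff)
    have "card (I - J) < card I"
      using J fin by (intro psubset_card_mono) auto
    moreover have "card K \<le> card (\<Union> ((\<lambda>i. N i - U) ` K))" if K: "K \<subseteq> I - J" for K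
    proof -
      have finK: "finite K" using K fin finite_subset by blast
      have "card J + card K = card (J \<union> K)"
        using K finJ finK by (intro card_Un_disjoint[symmetric]) auto
      also have "\<dots> \<le> card (\<Union> (N ` (J \<union> K)))"
        using J K by (intro hall) auto
      also have "\<Union> (N ` (J \<union> K)) = U \<union> \<Union> ((\<lambda>i. N i - U) ` K)"
        by (auto simp: U_def)
      also have "card \<dots> \<le> card U + card (\<Union> ((\<lambda>i. N i - U) ` K))"
        by (rule card_Un_le)
      finally show ?thesis using J(3) by (simp add: U_def)
    qed
    ultimately obtain g where g: "inj_on g (I - J)" "\<forall>i \<in> I - J. g i \<in> N i - U"
      using less.hyps[of "I - J" "\<lambda>i. N i - U"] fin by auto
    define h where "h i = (if i \<in> J then f i else g i)" for i
    have "inj_on h I"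
    proof (rule inj_onI)
      fix i j assume ij: "i \<in> I" "j \<in> I" "h i = h j"
      have fU: "f i \<in> U" if "i \<in> J" for i using f(2) that by (auto simp: U_def)
      have gU: "g i \<notin> U" if "i \<in> I - J" for i using g(2) that by auto
      show "i = j"
      proof (cases "i \<in> J"; cases "j \<in> J")
        assume "i \<in> J" "j \<in> J"
        then show ?thesis using ij f(1) by (simp add: h_def inj_on_def)
      next
        assume "i \<in> J" "j \<notin> J"
        then show ?thesis using ij fU[of i] gU[of j] by (simp add: h_def)
      next
        assume "i \<notin> J" "j \<in> J"
        then show ?thesis using ij fU[of j] gU[of i] by (simp add: h_def)
      next
        assume "i \<notin> J" "j \<notin> J"
        then show ?thesis using ij g(1) by (simp add: h_def inj_on_def)
      qed
    qed
    moreover have "\<forall>i \<in> I. h i \<in> N i" using f(2) g(2) by (auto simp: h_def)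
    ultimately show ?thesis by blast
  next
    case False
    show ?thesis
    proof (cases "I = {}")
      case True
      then show ?thesis by simp
    next
      case nonempty: False
      then obtain i where i: "i \<in> I" by blast
      have "card {i} \<le> card (\<Union> (N ` {i}))" using i by (intro hall) auto
      then have "N i \<noteq> {}" by auto
      then obtain x where x: "x \<in> N i" by blast
      have "card (I - {i}) < card I" using i fin(1) by (simp add: card_gt_0_iff nonempty)
      moreover have "card K \<le> card (\<Union> ((\<lambda>i. N i - {x}) ` K))" if K: "K \<subseteq> I - {i}" for K
      proof (cases "K = {}")
        case nK: False
        have "finite (\<Union> (N ` K))" using K fin finite_subset[of K I] by auto
        moreover have "K \<subset> I" using K i by auto
        then have "card K < card (\<Union> (N ` K))"
          using False nK not_le by blast
        moreover have "\<Union> ((\<lambda>i. N i - {x}) ` K) = \<Union> (N ` K) - {x}" by auto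
        ultimately show ?thesis by (auto simp: card_Diff_singleton_if)
      qed simp
      ultimately obtain g where g: "inj_on g (I - {i})" "\<forall>j \<in> I - {i}. g j \<in> N j - {x}"
        using less.hyps[of "I - {i}" "\<lambda>i. N i - {x}"] fin by auto
      have "inj_on (g(i := x)) I"
        using g i by (auto simp: inj_on_def)
      moreover have "\<forall>j \<in> I. (g(i := x)) j \<in> N j" using g(2) x by auto
      ultimately show ?thesis by blast
    qed
  qed
qed

section \<open>Odd barriers and their parity\<close>

lemma odd_card_Union:
  assumes "finite (\<Union> F)" "disjoint F" "\<forall>C \<in> F. odd (card C)"
  shows "even (card (\<Union> F)) \<longleftrightarrow> even (card F)"
proof -
  have "finite F" using assms(1) finite_UnionD by blast
  then have "card (\<Union> F) = (\<Sum>C \<in> F. card C)"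
    using assms by (intro card_Union_disjoint) (auto simp: disjoint_def pairwise_def disjnt_def intro: finite_subset)
  then show ?thesis using assms(3) \<open>finite F\<close> by (simp add: even_sum_iff[OF \<open>finite F\<close>] cong: conj_cong)
qed

lemma card_split_family:
  assumes "finite W" "Y \<subseteq> W" "\<Union> F \<subseteq> W - Y"
  shows "card W = card Y + card (\<Union> F) + card (W - Y - \<Union> F)"
proof -
  have "card W = card Y + card (W - Y)"
    using assms by (metis card_Diff_subset card_mono finite_subset le_add_diff_inverse)
  also have "card (W - Y) = card (\<Union> F) + card (W - Y - \<Union> F)"
    using assms by (metis card_Diff_subset card_mono finite_Diff finite_subset le_add_diff_inverse)
  finally show ?thesis by simp
qed

text \<open>
  The members of the family play the role of odd components of the graph on \<open>W - Y\<close>, but need not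
  be connected.
\<close>

definition odd_barrier :: "('a \<times> 'a) set \<Rightarrow> 'a set \<Rightarrow> 'a set \<Rightarrow> 'a set set \<Rightarrow> bool" where
  "odd_barrier E W Y F \<longleftrightarrow> Y \<subseteq> W \<and> disjoint F \<and>
     (\<forall>C \<in> F. C \<subseteq> W - Y \<and> odd (card C) \<and> E `` C \<inter> W \<subseteq> C \<union> Y)"

lemma odd_barrier_rest_closed:
  assumes "odd_barrier E W Y F" "sym E"
  shows "E `` (W - Y - \<Union> F) \<inter> W \<subseteq> (W - Y - \<Union> F) \<union> Y"
proof
  fix y assume "y \<in> E `` (W - Y - \<Union> F) \<inter> W"
  then obtain x where x: "x \<in> W" "x \<notin> Y" "x \<notin> \<Union> F" "(y, x) \<in> E" and y: "y \<in> W"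
    using assms(2) by (auto dest: symD)
  have "y \<notin> \<Union> F"
  proof
    assume "y \<in> \<Union> F"
    then obtain C where C: "C \<in> F" "y \<in> C" by blast
    then have "x \<in> E `` C \<inter> W" using x by blast
    moreover have "E `` C \<inter> W \<subseteq> C \<union> Y" using assms(1) C(1) by (simp add: odd_barrier_def)
    ultimately show False using C(1) x by blast
  qed
  then show "y \<in> (W - Y - \<Union> F) \<union> Y" using y by blast
qed

text \<open>The move for an even remainder: transferring one of its vertices to \<open>Y\<close>
  makes the remainder odd, and as a new member of \<open>F\<close> it keeps
  \<open>card F - card Y\<close> unchanged.\<close>

lemma odd_barrier_insert_rest:
  assumes "odd_barrier E W Y F" "sym E" "v \<in> W - Y - \<Union> F" "odd (card (W - Y - \<Union> F - {v}))"
  shows "odd_barrier E W (insert v Y) (insert (W - Y - \<Union> F - {v}) F)"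
    and "W - Y - \<Union> F - {v} \<notin> F"
proof -
  have "W - Y - \<Union> F - {v} \<noteq> {}" using assms(4) by force
  then show "W - Y - \<Union> F - {v} \<notin> F" by blast
  have "disjoint (insert (W - Y - \<Union> F - {v}) F)"
    using assms(1) by (auto simp: odd_barrier_def disjoint_def)
  moreover have "C \<subseteq> W - insert v Y \<and> odd (card C) \<and> E `` C \<inter> W \<subseteq> C \<union> insert v Y" if "C \<in> F" for C
  proof -
    have "C \<subseteq> W - Y \<and> odd (card C) \<and> E `` C \<inter> W \<subseteq> C \<union> Y"
      using assms(1) that by (simp add: odd_barrier_def)
    then show ?thesis using that assms(3) by blast
  qed
  moreover have "E `` (W - Y - \<Union> F - {v}) \<inter> W \<subseteq> (W - Y - \<Union> F - {v}) \<union> insert v Y"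
    using odd_barrier_rest_closed[OF assms(1,2)] by auto
  moreover have "insert v Y \<subseteq> W" using assms(1,3) by (simp add: odd_barrier_def)
  ultimately show "odd_barrier E W (insert v Y) (insert (W - Y - \<Union> F - {v}) F)"
    using assms(4) unfolding odd_barrier_def by blast
qed

text \<open>For even \<open>card W\<close> the sum of \<open>card F\<close>, \<open>card Y\<close>
  and the size of the remainder is even. An odd remainder joins \<open>F\<close> as a further
  member; an even one means that \<open>card F\<close> and \<open>card Y\<close> have the same
  parity, so that a strict surplus is at least two.\<close>

lemma odd_barrier_parity:
  assumes "odd_barrier E W Y F" "sym E" "finite W" "card F > card Y" "even (card W)"
  obtains F' where "odd_barrier E W Y F'" "card F' \<ge> card Y + 2"
proof -
  let ?R = "W - Y - \<Union> F"
  have F: "\<Union> F \<subseteq> W - Y" "disjoint F" "\<forall>C\<in>F. odd (card C)" "Y \<subseteq> W"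
    using assms(1) by (auto simp: odd_barrier_def)
  have fin: "finite (\<Union> F)" "finite Y" using F assms(3) by (auto intro: finite_subset)
  have finF: "finite F" using fin(1) finite_UnionD by blast
  have "card W = card Y + card (\<Union> F) + card ?R"
    using F assms(3) by (intro card_split_family)
  then have par: "even (card Y + card F + card ?R)"
    using odd_card_Union[OF fin(1) F(2,3)] assms(5) by auto
  show ?thesis
  proof (cases "odd (card ?R)")
    case True
    then have "?R \<noteq> {}" by force
    then have "?R \<notin> F" by blast
    moreover have "E `` ?R \<inter> W \<subseteq> ?R \<union> Y"
      by (rule odd_barrier_rest_closed[OF assms(1,2)])
    then have "odd_barrier E W Y (insert ?R F)"
      using assms(1) True by (auto simp: odd_barrier_def disjoint_def)
    ultimately show ?thesis using that[of "insert ?R F"] finF assms(4) by simp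
  next
    case False
    then have "card F \<noteq> card Y + 1" using par by auto
    then show ?thesis using that[of F] assms by simp
  qed
qed

text \<open>In the absence of a barrier with surplus, a tight one, with
  \<open>card F = card Y\<close>, of largest \<open>Y\<close> exhausts \<open>W\<close>. Maximality
  makes every member matchable after the loss of any one vertex, and Hall's theorem pairs the
  members with \<open>Y\<close>; these pieces form the perfect matching.\<close>

theorem tutte:
  assumes "finite W" "sym E" "irrefl E" "even (card W)"
  shows "(\<exists>M. M \<subseteq> {{u, v} |u v. (u, v) \<in> E \<and> u \<in> W \<and> v \<in> W} \<and> disjoint M \<and> \<Union> M = W) \<or>
    (\<exists>Y F. odd_barrier E W Y F \<and> card F > card Y)"
  using assms(1,4)
proof (induction "card W" arbitrary: W rule: less_induct)
  case less
  note fin = less.prems(1) and ev = less.prems(2)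
  let ?P = "\<lambda>W M. M \<subseteq> {{u, v} |u v. (u, v) \<in> E \<and> u \<in> W \<and> v \<in> W} \<and> disjoint M \<and> \<Union> M = W"
  show ?case
  proof (rule ccontr)
    assume neg: "\<not> ?case"
    then have noPM: "\<nexists>M. ?P W M" and nob: "\<And>Y F. odd_barrier E W Y F \<Longrightarrow> card F \<le> card Y"
      by (auto simp: not_less)
    have "W \<noteq> {}" using noPM by (auto simp: disjoint_def)
    then obtain v0 where v0: "v0 \<in> W" by blast
    let ?tight = "\<lambda>n. \<exists>Y F. odd_barrier E W Y F \<and> card F = card Y \<and> card Y = n"
    have "card W > 0" using v0 fin by (auto simp: card_gt_0_iff)
    then have "odd (card (W - {v0}))" using v0 fin ev by (auto simp: card_Diff_singleton)
    \<comment> \<open>Tight barriers exist because \<open>W\<close> is even: a single vertex against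
      all the others.\<close>
    then have "odd_barrier E W {v0} {W - {v0}}"
      using v0 by (auto simp: odd_barrier_def disjoint_def)
    then have "?tight 1" by (intro exI[of _ "{v0}"] exI[of _ "{W - {v0}}"]) auto
    moreover have "\<forall>n. ?tight n \<longrightarrow> n \<le> card W"
      using fin by (auto simp: odd_barrier_def card_mono)
    ultimately obtain n where n: "?tight n" "\<And>n'. ?tight n' \<Longrightarrow> n' \<le> n"
      using Nat.ex_has_greatest_nat[of ?tight 1 "card W"] by blast
    then obtain Y F where YF: "odd_barrier E W Y F" "card F = card Y" and nY: "card Y = n" by blast
    have F: "\<And>C. C \<in> F \<Longrightarrow> C \<subseteq> W - Y" "disjoint F" "\<And>C. C\<in>F \<Longrightarrow> odd (card C)" "Y \<subseteq> W"
      "\<And>C. C \<in> F \<Longrightarrow> E `` C \<inter> W \<subseteq> C \<union> Y"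
      using YF by (auto simp: odd_barrier_def)
    have "\<Union> F \<subseteq> W" using F by auto
    then have finF: "finite F" "finite (\<Union> F)" using fin by (auto intro: finite_UnionD finite_subset)
    have finY: "finite Y" by (rule finite_subset[OF F(4) fin])
    have cover: "W = Y \<union> \<Union> F"
    proof (rule ccontr)
      let ?R = "W - Y - \<Union> F"
      assume "W \<noteq> Y \<union> \<Union> F"
      then obtain v where v: "v \<in> ?R" using F by blast
      have "card W = card Y + card (\<Union> F) + card ?R"
        using F(1,4) fin by (intro card_split_family) auto
      then have "even (card ?R)"
        using odd_card_Union[of F] finF F ev YF(2) by auto
      moreover have "card ?R > 0" using v fin by (auto simp: card_gt_0_iff)
      moreover have "card (?R - {v}) = card ?R - 1" using v by (simp add: card_Diff_singleton)
      ultimately have o: "odd (card (?R - {v}))" by simp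
      note ins = odd_barrier_insert_rest[OF YF(1) assms(2) v o]
      have "?tight (Suc n)"
        using ins finF finY YF v nY by (intro exI[of _ "insert v Y"] exI[of _ "insert (?R - {v}) F"]) auto
      then show False using n(2)[of "Suc n"] by simp
    qed
    have near: "\<exists>M. ?P (C - {v}) M" if C: "C \<in> F" and v: "v \<in> C" for C v
    proof (rule ccontr)
      assume no: "\<nexists>M. ?P (C - {v}) M"
      have finC: "finite C" using F(1)[OF C] fin finite_subset by blast
      have "C - {v} \<subset> W" using F(1)[OF C] v by blast
      then have "card (C - {v}) < card W" using fin psubset_card_mono by blast
      moreover have evC: "even (card (C - {v}))" using F(3)[OF C] v finC by simp
      ultimately obtain Y1 F0 where b0: "odd_barrier E (C - {v}) Y1 F0" "card F0 > card Y1"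
        using less.hyps[of "C - {v}"] finC no by blast
      obtain F1 where b1: "odd_barrier E (C - {v}) Y1 F1" "card F1 \<ge> card Y1 + 2"
        using odd_barrier_parity[OF b0(1) assms(2) _ b0(2) evC] finC by blast
      have Y1: "Y1 \<subseteq> C - {v}" "disjoint F1" "\<And>D. D \<in> F1 \<Longrightarrow> D \<subseteq> C - {v} - Y1"
        "\<And>D. D \<in> F1 \<Longrightarrow> E `` D \<inter> (C - {v}) \<subseteq> D \<union> Y1" "\<And>D. D \<in> F1 \<Longrightarrow> odd (card D)"
        using b1 by (auto simp: odd_barrier_def)
      \<comment> \<open>Replacing \<open>C\<close> by \<open>F1\<close> loses one member and gains
        at least \<open>card Y1 + 2\<close>, while \<open>Y\<close> grows by
        \<open>card Y1 + 1\<close>. The new barrier is tight again, with a larger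
        \<open>Y\<close>.\<close>
      define Y' where "Y' = Y \<union> insert v Y1"
      define F' where "F' = (F - {C}) \<union> F1"
      have "disjoint F'"
        unfolding disjoint_def
      proof (intro ballI impI)
        fix A B assume AB: "A \<in> F'" "B \<in> F'" "A \<noteq> B"
        have dis: "D \<inter> D' = {}" "D' \<inter> D = {}" if "D \<in> F1" "D' \<in> F - {C}" for D D'
          using that F(2) C Y1(3)[of D] by (auto simp: disjoint_def)
        show "A \<inter> B = {}"
          using AB dis disjointD[OF F(2), of A B] disjointD[OF Y1(2), of A B]
          unfolding F'_def Un_iff by (elim disjE) simp_all
      qed
      moreover have "D \<subseteq> W - Y' \<and> odd (card D) \<and> E `` D \<inter> W \<subseteq> D \<union> Y'" if D: "D \<in> F'" for D
      proof (cases "D \<in> F1")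
        case True
        then show ?thesis
          using Y1(3,4,5)[OF True] F(1,5)[OF C] v unfolding Y'_def by blast
      next
        case False
        then have "D \<in> F" "D \<noteq> C" using D by (auto simp: F'_def)
        then have "D \<inter> C = {}" using F(2) C by (auto simp: disjoint_def)
        then show ?thesis
          using F(1,3,5)[OF \<open>D \<in> F\<close>] Y1(1) v unfolding Y'_def by blast
      qed
      moreover have "Y' \<subseteq> W" using F(1)[OF C] F(4) Y1(1) v by (auto simp: Y'_def)
      ultimately have b': "odd_barrier E W Y' F'" by (auto simp: odd_barrier_def)
      have finF1: "finite F1" using b1 by (metis card.infinite add_is_0 le_zero_eq zero_neq_numeral)
      have "(F - {C}) \<inter> F1 = {}"
      proof (rule ccontr)
        assume "(F - {C}) \<inter> F1 \<noteq> {}"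
        then obtain D where D: "D \<in> F" "D \<noteq> C" "D \<in> F1" by blast
        then have "D \<inter> C = {}" using F(2) C by (auto simp: disjoint_def)
        then have "D = {}" using Y1(3)[OF D(3)] by auto
        then show False using F(3)[OF D(1)] by simp
      qed
      then have cF: "card F' = card F - 1 + card F1"
        unfolding F'_def using finF finF1 C by (subst card_Un_disjoint) auto
      have "finite Y1" using Y1(1) finC by (meson finite_Diff finite_subset)
      moreover have "Y \<inter> insert v Y1 = {}" "v \<notin> Y1"
        using F(1)[OF C] Y1(1) v by auto
      ultimately have cY: "card Y' = card Y + 1 + card Y1"
        unfolding Y'_def using finY by (subst card_Un_disjoint) auto
      have "card F > 0" using C finF by (auto simp: card_gt_0_iff)
      then have "card F' = card Y'" using nob[OF b'] cF cY YF(2) b1(2) by linarith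
      then have "card Y' \<le> n" using n(2)[of "card Y'"] b' by blast
      then show False using cY nY by simp
    qed
    have "\<exists>f. inj_on f F \<and> (\<forall>C \<in> F. f C \<in> E `` C \<inter> Y)"
    proof (rule hall_marriage[OF finF(1)])
      fix S assume S: "S \<subseteq> F"
      \<comment> \<open>Hall's condition: a subfamily with too few neighbours in \<open>Y\<close>
        would itself be a barrier with surplus.\<close>
      have "odd_barrier E W (\<Union>C\<in>S. E `` C \<inter> Y) S"
        unfolding odd_barrier_def
      proof (intro conjI ballI)
        show "(\<Union>C\<in>S. E `` C \<inter> Y) \<subseteq> W" using F(4) by blast
        show "disjoint S" using S F(2) by (auto simp: disjoint_def)
        fix C assume "C \<in> S"
        then have C: "C \<in> F" using S by blast
        show "C \<subseteq> W - (\<Union>C\<in>S. E `` C \<inter> Y)" using F(1)[OF C] by blast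
        show "odd (card C)" using F(3)[OF C] .
        show "E `` C \<inter> W \<subseteq> C \<union> (\<Union>C\<in>S. E `` C \<inter> Y)"
          using F(5)[OF C] \<open>C \<in> S\<close> by blast
      qed
      then show "card S \<le> card (\<Union>C\<in>S. E `` C \<inter> Y)" by (rule nob)
    qed (use finY in auto)
    then obtain f where f: "inj_on f F" "\<And>C. C \<in> F \<Longrightarrow> f C \<in> E `` C \<inter> Y" by blast
    have fY: "f ` F = Y"
      using f finY YF(2) by (intro card_subset_eq) (auto simp: card_image)
    have "\<forall>C \<in> F. \<exists>v. v \<in> C \<and> (v, f C) \<in> E" using f(2) by blast
    then obtain w where w: "\<And>C. C \<in> F \<Longrightarrow> w C \<in> C \<and> (w C, f C) \<in> E" by metis
    define m where "m C = (SOME M. ?P (C - {w C}) M)" for C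
    have m: "?P (C - {w C}) (m C)" if "C \<in> F" for C
      unfolding m_def by (rule someI_ex, rule near[OF that conjunct1[OF w[OF that]]])
    have mU: "\<Union> (m C) = C - {w C}" if "C \<in> F" for C using m[OF that] by simp
    have mE: "\<exists>u v. e = {u, v} \<and> (u, v) \<in> E \<and> u \<in> C \<and> v \<in> C" if "C \<in> F" "e \<in> m C" for C e
      using m[OF that(1)] that(2) by blast
    define M where "M = (\<Union>C\<in>F. insert {w C, f C} (m C))"
    have U: "\<Union> (insert {w C, f C} (m C)) = insert (f C) C" if "C \<in> F" for C
      using mU[OF that] w[OF that] by auto
    have "\<Union> M = (\<Union>C\<in>F. \<Union> (insert {w C, f C} (m C)))" by (auto simp: M_def)
    also have "\<dots> = (\<Union>C\<in>F. insert (f C) C)" using U by auto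
    also have "\<dots> = W" using fY cover by auto
    finally have UM: "\<Union> M = W" .
    have "M \<subseteq> {{u, v} |u v. (u, v) \<in> E \<and> u \<in> W \<and> v \<in> W}"
    proof
      fix e assume "e \<in> M"
      then obtain C where C: "C \<in> F" "e \<in> insert {w C, f C} (m C)" by (auto simp: M_def)
      show "e \<in> {{u, v} |u v. (u, v) \<in> E \<and> u \<in> W \<and> v \<in> W}"
      proof (cases "e = {w C, f C}")
        case True
        then show ?thesis using w[OF C(1)] f(2)[OF C(1)] F(1)[OF C(1)] F(4) by blast
      next
        case False
        then have "e \<in> m C" using C by simp
        then show ?thesis using mE[OF C(1)] F(1)[OF C(1)] by blast
      qed
    qed
    moreover have "disjoint M"
      unfolding disjoint_def
    proof (intro ballI impI)
      fix e e' assume e: "e \<in> M" "e' \<in> M" "e \<noteq> e'"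
      then obtain C C' where C: "C \<in> F" "e \<in> insert {w C, f C} (m C)"
        and C': "C' \<in> F" "e' \<in> insert {w C', f C'} (m C')" by (auto simp: M_def)
      show "e \<inter> e' = {}"
      proof (cases "C = C'")
        case True
        have "f C \<notin> C" using f(2)[OF C(1)] F(1)[OF C(1)] by auto
        then have "{w C, f C} \<inter> e'' = {}" if "e'' \<in> m C" for e''
          using mU[OF C(1)] that by blast
        then show ?thesis
          using C C' e(3) conjunct1[OF conjunct2[OF m[OF C(1)]]] True
          by (metis disjointD inf_commute insert_iff)
      next
        case False
        have "e \<subseteq> insert (f C) C" "e' \<subseteq> insert (f C') C'" using U C C' by blast+
        moreover have "C \<inter> C' = {}" using F(2) C C' False by (auto simp: disjoint_def)
        moreover have "f C \<noteq> f C'" using f(1) C C' False by (auto simp: inj_on_def)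
        moreover have "f C \<notin> C'" "f C' \<notin> C"
          using f(2)[OF C(1)] f(2)[OF C'(1)] F(1)[OF C(1)] F(1)[OF C'(1)] by auto
        ultimately show ?thesis by blast
      qed
    qed
    ultimately show False using UM noPM by blast
  qed
qed

section \<open>Neighbourhood expansion in vertex-transitive relations\<close>

definition rel_automorphism :: "'a set \<Rightarrow> ('a \<times> 'a) set \<Rightarrow> ('a \<Rightarrow> 'a) \<Rightarrow> bool" where
  "rel_automorphism V R f \<longleftrightarrow>
     bij_betw f V V \<and> (\<forall>u \<in> V. \<forall>v \<in> V. (f u, f v) \<in> R \<longleftrightarrow> (u, v) \<in> R)"

text \<open>Loops are allowed, so that the theory covers neighbourhoods in \<open>E\<close> and,
  with \<open>E \<union> Id_on V\<close> in place of \<open>E\<close>, closed neighbourhoods.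
  Connectedness is the absence of proper nonempty closed sets, the form in which it is
  applied.\<close>

locale transitive_relation =
  fixes V :: "'a set" and R :: "('a \<times> 'a) set"
  assumes finite_V: "finite V"
    and R_sub: "R \<subseteq> V \<times> V"
    and R_sym: "sym R"
    and transitive: "x \<in> V \<Longrightarrow> y \<in> V \<Longrightarrow> \<exists>f. rel_automorphism V R f \<and> f x = y"
    and connected: "S \<subseteq> V \<Longrightarrow> S \<noteq> {} \<Longrightarrow> R `` S \<subseteq> S \<Longrightarrow> S = V"
begin

lemma symR: "(x, y) \<in> R \<Longrightarrow> (y, x) \<in> R"
  using R_sym by (rule symD)

lemma Image_sub: "R `` S \<subseteq> V"
  using R_sub by auto

lemma finite_sub: "S \<subseteq> V \<Longrightarrow> finite S"
  using finite_V finite_subset by blast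

lemma automorphism_Image:
  assumes "rel_automorphism V R f" "S \<subseteq> V"
  shows "R `` (f ` S) = f ` (R `` S)"
proof -
  have f: "f ` V = V" "\<And>u v. u \<in> V \<Longrightarrow> v \<in> V \<Longrightarrow> (f u, f v) \<in> R \<longleftrightarrow> (u, v) \<in> R"
    using assms(1) by (auto simp: rel_automorphism_def bij_betw_def)
  show ?thesis
  proof
    show "R `` (f ` S) \<subseteq> f ` (R `` S)"
    proof
      fix y assume "y \<in> R `` (f ` S)"
      then obtain x where x: "x \<in> S" "(f x, y) \<in> R" by blast
      then have "y \<in> f ` V" using f(1) R_sub by auto
      then obtain z where "z \<in> V" "y = f z" by blast
      then show "y \<in> f ` (R `` S)" using x f(2) assms(2) by blast
    qed
    show "f ` (R `` S) \<subseteq> R `` (f ` S)"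
      using f(2) assms(2) R_sub by fast
  qed
qed

lemma automorphism_card:
  assumes "rel_automorphism V R f" "S \<subseteq> V"
  shows "card (f ` S) = card S"
  using assms by (meson bij_betw_def card_image inj_on_subset rel_automorphism_def)

lemma automorphism_range:
  assumes "rel_automorphism V R f" "S \<subseteq> V"
  shows "f ` S \<subseteq> V"
  using assms by (auto simp: rel_automorphism_def bij_betw_def)

section \<open>Sets of least neighbourhood excess and their atoms\<close>

definition excess :: "'a set \<Rightarrow> int" where
  "excess S = int (card (R `` S)) - int (card S)"

definition admissible :: "'a set \<Rightarrow> bool" where
  "admissible S \<longleftrightarrow> S \<subseteq> V \<and> S \<noteq> {} \<and> R `` S \<noteq> V"

lemma excess_submodular:
  assumes "S \<subseteq> V" "T \<subseteq> V"
  shows "excess (S \<inter> T) + excess (S \<union> T) \<le> excess S + excess T"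
proof -
  have fin: "finite S" "finite T" "finite (R `` S)" "finite (R `` T)"
    using assms Image_sub finite_sub by auto
  have "card (S \<inter> T) + card (S \<union> T) = card S + card T"
    using card_Un_Int[OF fin(1,2)] by simp
  moreover have "card (R `` (S \<inter> T)) \<le> card (R `` S \<inter> R `` T)"
    using fin by (intro card_mono) auto
  moreover have "card (R `` S \<inter> R `` T) + card (R `` (S \<union> T)) = card (R `` S) + card (R `` T)"
    using card_Un_Int[OF fin(3,4)] by (simp add: Image_Un)
  ultimately show ?thesis by (simp add: excess_def)
qed

lemma automorphism_admissible:
  assumes "rel_automorphism V R f" "admissible S"
  shows "admissible (f ` S)" and "excess (f ` S) = excess S"
proof -
  have S: "S \<subseteq> V" "S \<noteq> {}" "R `` S \<noteq> V" using assms(2) by (auto simp: admissible_def)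
  have c: "card (R `` (f ` S)) = card (R `` S)"
    using automorphism_Image[OF assms(1) S(1)] automorphism_card[OF assms(1) Image_sub] by simp
  then show "excess (f ` S) = excess S"
    using automorphism_card[OF assms(1) S(1)] by (simp add: excess_def)
  have "card (R `` S) < card V" using S Image_sub finite_V by (metis psubset_card_mono psubsetI)
  then have "R `` (f ` S) \<noteq> V" using c by auto
  then show "admissible (f ` S)"
    using S automorphism_range[OF assms(1)] by (auto simp: admissible_def)
qed

definition fragment :: "'a set \<Rightarrow> bool" where
  "fragment S \<longleftrightarrow> admissible S \<and> (\<forall>T. admissible T \<longrightarrow> excess S \<le> excess T)"

definition atom :: "'a set \<Rightarrow> bool" where
  "atom Q \<longleftrightarrow> fragment Q \<and> (\<forall>T. fragment T \<longrightarrow> card Q \<le> card T)"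

lemma fragment_excess_eq: "fragment S \<Longrightarrow> fragment T \<Longrightarrow> excess S = excess T"
  by (meson fragment_def order_antisym)

lemma fragment_sub: "fragment S \<Longrightarrow> S \<subseteq> V" "fragment S \<Longrightarrow> S \<noteq> {}" "fragment S \<Longrightarrow> R `` S \<noteq> V"
  by (auto simp: fragment_def admissible_def)

lemma atom_card_eq: "atom P \<Longrightarrow> atom Q \<Longrightarrow> card P = card Q"
  by (meson atom_def order_antisym)

lemma fragmentI:
  assumes "fragment S" "admissible T" "excess T \<le> excess S"
  shows "fragment T"
  using assms unfolding fragment_def by force

lemma atom_exists:
  assumes "admissible S"
  obtains Q where "atom Q"
proof -
  have "finite {T. admissible T}"
    by (rule finite_subset[of _ "Pow V"]) (auto simp: admissible_def finite_V)
  then obtain F where "F \<in> {T. admissible T}" "\<And>T. T \<in> {T. admissible T} \<Longrightarrow> excess F \<le> excess T"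
    using assms arg_min_if_finite[of "{T. admissible T}" excess]
    by (metis arg_min_least empty_iff mem_Collect_eq)
  then have F: "fragment F" by (auto simp: fragment_def)
  define n where "n = (LEAST n. \<exists>T. fragment T \<and> card T = n)"
  have "\<exists>T. fragment T \<and> card T = n" unfolding n_def by (rule LeastI) (use F in blast)
  moreover have "\<And>T. fragment T \<Longrightarrow> n \<le> card T" unfolding n_def by (rule Least_le) blast
  ultimately show ?thesis using that by (auto simp: atom_def)
qed

text \<open>No vertex outside N(S) is adjacent to \<open>S\<close>, so the complement of N(S) has
  its image inside \<open>V - S\<close> and an excess at most that of \<open>S\<close>; minimality
  forces equality.\<close>

lemma fragment_dual:
  assumes "fragment S"
  shows "fragment (V - R `` S)" and "R `` (V - R `` S) = V - S"
proof -
  note S = fragment_sub[OF assms]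
  have sub: "R `` (V - R `` S) \<subseteq> V - S" using Image_sub symR by blast
  have finS: "finite S" "finite (R `` S)" using S Image_sub finite_sub by auto
  have "V - R `` S \<noteq> {}" using S(3) Image_sub by blast
  moreover have "R `` (V - R `` S) \<noteq> V" using sub S(1,2) by blast
  ultimately have adm: "admissible (V - R `` S)" by (simp add: admissible_def)
  have c: "card (V - S) = card V - card S" "card (V - R `` S) = card V - card (R `` S)"
    using S(1) Image_sub finS by (auto simp: card_Diff_subset)
  have le: "card S \<le> card V" "card (R `` S) \<le> card V"
    using S(1) Image_sub finite_V by (simp_all add: card_mono)
  have "card (R `` (V - R `` S)) \<le> card (V - S)"
    using sub finite_V by (intro card_mono) auto
  then have "excess (V - R `` S) \<le> excess S" using c le by (simp add: excess_def)
  then show fr: "fragment (V - R `` S)" by (rule fragmentI[OF assms adm])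
  have "card (R `` (V - R `` S)) = card (V - S)"
    using fragment_excess_eq[OF fr assms] c le by (simp add: excess_def)
  then show "R `` (V - R `` S) = V - S"
    using sub finite_V by (intro card_subset_eq) auto
qed

text \<open>Uncrossing: a proper intersection is smaller than an atom, so its excess is above the
  minimum, and submodularity pushes that of the union below it. A union with full image is not
  admissible; there the estimate comes from the dual of \<open>F\<close>, which as a fragment is no
  smaller than \<open>Q\<close>.\<close>

lemma atom_subset_fragment:
  assumes Q: "atom Q" and F: "fragment F" and QF: "Q \<inter> F \<noteq> {}"
  shows "Q \<subseteq> F"
proof (rule ccontr)
  assume n: "\<not> Q \<subseteq> F"
  have fQ: "fragment Q" using Q by (simp add: atom_def)
  note S = fragment_sub[OF fQ] fragment_sub[OF F]
  have finQ: "finite Q" "finite F" using S finite_sub by auto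
  have lt: "card (Q \<inter> F) < card Q" using n finQ by (intro psubset_card_mono) auto
  have adm: "admissible (Q \<inter> F)"
    using QF S Image_sub[of Q] by (auto simp: admissible_def)
  have nf: "\<not> fragment (Q \<inter> F)" using Q lt by (auto simp: atom_def not_le[symmetric])
  have h: "excess (Q \<inter> F) > excess Q" using fragmentI[OF fQ adm] nf by force
  have sub: "excess (Q \<inter> F) + excess (Q \<union> F) \<le> 2 * excess Q"
    using excess_submodular[OF S(1,4)] fragment_excess_eq[OF F fQ] by simp
  show False
  proof (cases "R `` (Q \<union> F) = V")
    case False
    then have "admissible (Q \<union> F)" using S by (auto simp: admissible_def)
    then have "excess Q \<le> excess (Q \<union> F)" using fQ by (simp add: fragment_def)
    then show ?thesis using h sub by simp
  next
    case True
    have d: "card Q \<le> card (V - R `` F)"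
      using Q fragment_dual(1)[OF F] by (auto simp: atom_def)
    have c: "card (V - R `` F) = card V - card (R `` F)" "card (R `` F) \<le> card V"
      using Image_sub finite_V by (auto simp: card_Diff_subset finite_sub card_mono)
    have "card (Q \<union> F) + card (Q \<inter> F) = card Q + card F"
      using card_Un_Int[OF finQ] by simp
    moreover have "excess (Q \<union> F) = int (card V) - int (card (Q \<union> F))"
      using True by (simp add: excess_def)
    moreover have "int (card Q) \<le> int (card V) - int (card F) - excess F"
      using d c by (simp add: excess_def)
    ultimately have "excess (Q \<union> F) \<ge> excess F + int (card (Q \<inter> F))"
      by linarith
    then show ?thesis using h sub fragment_excess_eq[OF F fQ] by linarith
  qed
qed

lemma atom_eq: "atom P \<Longrightarrow> atom Q \<Longrightarrow> P \<inter> Q \<noteq> {} \<Longrightarrow> P = Q"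
  using atom_subset_fragment[of P Q] atom_subset_fragment[of Q P] by (auto simp: atom_def)

lemma atom_image:
  assumes "rel_automorphism V R f" "atom Q"
  shows "atom (f ` Q)"
proof -
  have fQ: "fragment Q" using assms by (simp add: atom_def)
  then have aQ: "admissible Q" by (simp add: fragment_def)
  then have "fragment (f ` Q)"
    using automorphism_admissible[OF assms(1) aQ] fragmentI[OF fQ] by simp
  then show ?thesis
    using assms automorphism_card[OF assms(1) fragment_sub(1)[OF fQ]] by (simp add: atom_def)
qed

text \<open>Together with \<open>atom_eq\<close> this makes the atoms a partition of
  \<open>V\<close> into blocks that the automorphisms permute transitively.\<close>

lemma atom_through:
  assumes "atom Q" "y \<in> V"
  obtains f where "rel_automorphism V R f" "y \<in> f ` Q" "atom (f ` Q)"
proof -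
  have "fragment Q" using assms(1) by (simp add: atom_def)
  then obtain x where x: "x \<in> Q" "x \<in> V" using fragment_sub(1,2)[of Q] by blast
  then obtain f where f: "rel_automorphism V R f" "f x = y" using transitive assms(2) by blast
  then have "y \<in> f ` Q" using x by blast
  then show ?thesis using that f(1) atom_image[OF f(1) assms(1)] by blast
qed

lemma atom_conjugate:
  assumes "atom P" "atom Q"
  obtains f where "rel_automorphism V R f" "P = f ` Q"
proof -
  have "fragment P" using assms(1) by (simp add: atom_def)
  then obtain y where y: "y \<in> P" "y \<in> V" using fragment_sub(1,2)[of P] by blast
  obtain f where f: "rel_automorphism V R f" "y \<in> f ` Q" "atom (f ` Q)"
    by (rule atom_through[OF assms(2) y(2)])
  then have "P = f ` Q" using atom_eq[OF assms(1) f(3)] y by blast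
  then show ?thesis using that f by blast
qed

lemma atom_card_dvd:
  assumes Q: "atom Q" and S: "S \<subseteq> V" and "\<And>P. atom P \<Longrightarrow> P \<inter> S \<noteq> {} \<Longrightarrow> P \<subseteq> S"
  shows "card Q dvd card S"
proof -
  let ?A = "{P. atom P \<and> P \<subseteq> S}"
  have "S \<subseteq> \<Union> ?A"
  proof
    fix y assume y: "y \<in> S"
    then obtain f where "y \<in> f ` Q" "atom (f ` Q)" using atom_through[OF Q] S by blast
    then show "y \<in> \<Union> ?A" using assms(3)[of "f ` Q"] y by blast
  qed
  then have U: "\<Union> ?A = S" by blast
  have "card Q dvd card (\<Union> ?A)"
  proof (rule dvd_partition)
    show "finite (\<Union> ?A)" using U S finite_sub by simp
    show "\<forall>c\<in>?A. card Q dvd card c" using atom_card_eq[OF Q] by auto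
    show "\<forall>c1\<in>?A. \<forall>c2\<in>?A. c1 \<noteq> c2 \<longrightarrow> c1 \<inter> c2 = {}" using atom_eq by blast
  qed
  then show ?thesis using U by simp
qed

text \<open>The dual of \<open>F\<close> is a fragment and so contains or misses every atom; its
  complement N(F) is therefore a union of atoms.\<close>

lemma atom_Image_union:
  assumes "atom P" "fragment F" "P \<inter> R `` F \<noteq> {}"
  shows "P \<subseteq> R `` F"
proof -
  have "P \<inter> (V - R `` F) = {}"
    using assms atom_subset_fragment[OF assms(1) fragment_dual(1)[OF assms(2)]] by blast
  then show ?thesis using fragment_sub(1)[of P] assms(1) by (auto simp: atom_def)
qed

text \<open>N(Q) is a single atom \<open>P\<close>, and N(P) is an atom meeting \<open>Q\<close>,
  hence \<open>Q\<close> itself. So \<open>Q \<union> P\<close> is closed, and by connectedness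
  \<open>Q\<close> and \<open>P\<close> are the two colour classes.\<close>

lemma atom_exact_image:
  assumes nbr: "\<And>v. v \<in> V \<Longrightarrow> R `` {v} \<noteq> {}" and Q: "atom Q" and c: "card (R `` Q) = card Q"
  shows "\<exists>U W. V = U \<union> W \<and> U \<inter> W = {} \<and> R \<subseteq> U \<times> W \<union> W \<times> U"
proof -
  have fQ: "fragment Q" and Q': "Q \<subseteq> V" "Q \<noteq> {}" "R `` Q \<noteq> V"
    using Q fragment_sub by (auto simp: atom_def)
  have im: "\<exists>P'. atom P' \<and> R `` P = P'" if P: "atom P" for P
  proof -
    have fP: "fragment P" using P by (simp add: atom_def)
    then obtain p where p: "p \<in> P" "p \<in> V" using fragment_sub(1,2)[of P] by blast
    then have "R `` {p} \<subseteq> R `` P" by blast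
    then obtain y where y: "y \<in> R `` P" using nbr[OF p(2)] by blast
    then have "y \<in> V" using R_sub by blast
    then obtain P' where P': "atom P'" "y \<in> P'" using atom_through[OF Q] by metis
    have "P' \<subseteq> R `` P" using atom_Image_union[OF P'(1) fP] P'(2) y by blast
    moreover have "card (R `` P) = card P'"
    proof -
      obtain f where f: "rel_automorphism V R f" "P = f ` Q" by (rule atom_conjugate[OF P Q])
      have "card (R `` P) = card (R `` Q)"
        using automorphism_Image[OF f(1) Q'(1)] automorphism_card[OF f(1) Image_sub] f(2) by simp
      then show ?thesis using c atom_card_eq[OF Q P'(1)] by simp
    qed
    ultimately have "R `` P = P'" using Image_sub finite_sub by (metis card_subset_eq)
    then show ?thesis using P' by blast
  qed
  obtain P where P: "atom P" "R `` Q = P" using im[OF Q] by blast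
  obtain Q2 where Q2: "atom Q2" "R `` P = Q2" using im[OF P(1)] by blast
  have "P \<noteq> {}" using P(1) fragment_sub by (auto simp: atom_def)
  then have "Q2 \<inter> Q \<noteq> {}" using P(2) Q2(2) symR by blast
  then have PQ: "R `` P = Q" using atom_eq[OF Q2(1) Q] Q2(2) by simp
  have "Q \<union> P = V"
    using P PQ Q' by (intro connected) (auto simp: Image_Un fragment_sub atom_def)
  moreover have "Q \<noteq> P" using calculation P Q' by auto
  then have "Q \<inter> P = {}" using atom_eq[OF Q P(1)] by blast
  moreover have "R \<subseteq> Q \<times> P \<union> P \<times> Q"
    using calculation(1) P(2) PQ R_sub by blast
  ultimately show ?thesis by blast
qed

text \<open>Were \<open>Q\<close> to meet its image, the image would be \<open>Q \<union> P\<close>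
  for a second atom \<open>P\<close>. By conjugacy N(P) consists of \<open>P\<close> and one more
  atom, which is \<open>Q\<close> by symmetry of \<open>R\<close>. Then \<open>Q \<union> P\<close>
  is closed and equals \<open>V\<close>, although N(Q) is not \<open>V\<close>.\<close>

lemma atom_double_image:
  assumes Q: "atom Q" and c: "card (R `` Q) = 2 * card Q"
  shows "Q \<inter> R `` Q = {}"
proof (rule ccontr)
  assume n: "Q \<inter> R `` Q \<noteq> {}"
  have fQ: "fragment Q" and Q': "Q \<subseteq> V" "Q \<noteq> {}" "R `` Q \<noteq> V"
    using Q fragment_sub by (auto simp: atom_def)
  have finQ: "finite Q" "finite (R `` Q)" using Q' Image_sub finite_sub by auto
  have QR: "Q \<subseteq> R `` Q" using atom_Image_union[OF Q fQ n] .
  define P where "P = R `` Q - Q"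
  have cP: "card P = card Q" using c QR finQ by (simp add: P_def card_Diff_subset)
  then have "P \<noteq> {}" using Q'(2) finQ by auto
  then obtain y where y: "y \<in> P" by blast
  then have "y \<in> V" using P_def R_sub by blast
  then obtain f where f: "rel_automorphism V R f" "y \<in> f ` Q" "atom (f ` Q)"
    using atom_through[OF Q] by blast
  have "f ` Q \<subseteq> R `` Q" using atom_Image_union[OF f(3) fQ] f(2) y by (auto simp: P_def)
  moreover have "f ` Q \<inter> Q = {}" using atom_eq[OF f(3) Q] f(2) y by (auto simp: P_def)
  ultimately have "f ` Q \<subseteq> P" by (auto simp: P_def)
  moreover have "card (f ` Q) = card P" using cP atom_card_eq[OF f(3) Q] by simp
  ultimately have fP: "f ` Q = P" using finQ by (metis P_def card_subset_eq finite_Diff)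
  then have P: "atom P" "fragment P" using f(3) by (auto simp: atom_def)
  have im: "R `` P = f ` (R `` Q)" using automorphism_Image[OF f(1) Q'(1)] fP by simp
  have "P \<subseteq> R `` P" using image_mono[OF QR, of f] im fP by simp
  moreover have "Q \<inter> R `` P \<noteq> {}"
  proof -
    obtain x where x: "x \<in> Q" "(x, y) \<in> R" using y by (auto simp: P_def)
    then have "x \<in> R `` P" using symR y by blast
    then show ?thesis using x by blast
  qed
  then have "Q \<subseteq> R `` P" by (rule atom_Image_union[OF Q P(2)])
  ultimately have "Q \<union> P \<subseteq> R `` P" by blast
  moreover have "card (R `` P) = card (Q \<union> P)"
    using im automorphism_card[OF f(1) Image_sub[of Q]] c cP finQ
    by (subst card_Un_disjoint) (auto simp: P_def)
  ultimately have "R `` P = Q \<union> P" using Image_sub finite_sub by (metis card_subset_eq)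
  moreover have "R `` Q = Q \<union> P" using QR by (auto simp: P_def)
  ultimately have "Q \<union> P = V" using Q' fragment_sub(1)[OF P(2)] by (intro connected) auto
  then show False using Q'(3) \<open>R `` Q = Q \<union> P\<close> by simp
qed

text \<open>
  A largest fragment \<open>F\<close> disjoint from its image satisfies \<open>F \<union> R `` F = V\<close>, since otherwise an atom
  could be added to it; so \<open>card V = 2 * card F + card Q\<close>.
\<close>

lemma atom_double_image_even:
  assumes Q: "atom Q" and c: "card (R `` Q) = 2 * card Q" and ev: "even (card V)"
  shows "even (card Q)"
proof -
  have fQ: "fragment Q" and Q': "Q \<subseteq> V" "Q \<noteq> {}"
    using Q fragment_sub by (auto simp: atom_def)
  have cI: "card (R `` P) = 2 * card Q" if P: "atom P" for P
  proof -
    obtain f where f: "rel_automorphism V R f" "P = f ` Q" by (rule atom_conjugate[OF P Q])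
    then show ?thesis
      using automorphism_Image[OF f(1) Q'(1)] automorphism_card[OF f(1) Image_sub] c by simp
  qed
  let ?ind = "\<lambda>n. \<exists>F. fragment F \<and> F \<inter> R `` F = {} \<and> card F = n"
  have "?ind (card Q)" using fQ atom_double_image[OF Q c] by blast
  moreover have "\<forall>n. ?ind n \<longrightarrow> n \<le> card V"
    using finite_V by (auto dest: fragment_sub simp: card_mono)
  ultimately obtain n where n: "?ind n" "\<And>n'. ?ind n' \<Longrightarrow> n' \<le> n"
    using Nat.ex_has_greatest_nat[of ?ind "card Q" "card V"] by blast
  then obtain F where F: "fragment F" "F \<inter> R `` F = {}" "card F = n" by blast
  note F' = fragment_sub[OF F(1)]
  have finF: "finite F" "finite (R `` F)" using F' Image_sub finite_sub by auto
  have ex: "excess F = int (card Q)"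
    using fragment_excess_eq[OF F(1) fQ] c by (simp add: excess_def)
  have "F \<union> R `` F = V"
  proof (rule ccontr)
    assume "F \<union> R `` F \<noteq> V"
    then have "\<not> R `` (F \<union> R `` F) \<subseteq> F \<union> R `` F"
      using connected[of "F \<union> R `` F"] F' Image_sub by blast
    then obtain x y where xy: "x \<in> R `` F" "(x, y) \<in> R" "y \<notin> F" "y \<notin> R `` F" by blast
    then have "x \<in> V" "y \<in> V" using R_sub by auto
    \<comment> \<open>The arc from \<open>x\<close> to \<open>y\<close> puts the atom
      \<open>P\<close> into both N(F) and N(Q1). Of the \<open>2 * card Q\<close> vertices of N(Q1)
      at most \<open>card Q\<close> are then new, so adding \<open>Q1\<close> to \<open>F\<close>
      does not raise the excess.\<close>
    then obtain P Q1 where P: "atom P" "x \<in> P" and Q1: "atom Q1" "y \<in> Q1"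
      using atom_through[OF Q] by metis
    have fQ1: "fragment Q1" using Q1 by (simp add: atom_def)
    note Q1' = fragment_sub[OF fQ1]
    have "P \<subseteq> R `` F" using atom_Image_union[OF P(1) F(1)] P xy by blast
    moreover have "P \<subseteq> R `` Q1" using atom_Image_union[OF P(1) fQ1] P(2) Q1(2) symR[OF xy(2)] by blast
    moreover have Q1F: "Q1 \<inter> F = {}" using atom_subset_fragment[OF Q1(1) F(1)] Q1 xy by blast
    moreover have Q1R: "Q1 \<inter> R `` F = {}" using atom_Image_union[OF Q1(1) F(1)] Q1 xy by blast
    moreover have Q1Q1: "Q1 \<inter> R `` Q1 = {}"
      using atom_double_image[OF Q1(1)] cI[OF Q1(1)] atom_card_eq[OF Q1(1) Q] by simp
    ultimately have PI: "P \<subseteq> R `` F \<inter> R `` Q1" by blast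
    define F1 where "F1 = F \<union> Q1"
    have cF1: "card F1 = card F + card Q"
      unfolding F1_def using Q1F finF Q1' finite_sub atom_card_eq[OF Q1(1) Q]
      by (subst card_Un_disjoint) auto
    have "card (R `` F1) + card (R `` F \<inter> R `` Q1) = card (R `` F) + card (R `` Q1)"
      unfolding F1_def Image_Un using card_Un_Int[of "R `` F" "R `` Q1"] finF Image_sub finite_sub by simp
    moreover have "card Q \<le> card (R `` F \<inter> R `` Q1)"
      using card_mono[OF _ PI] finF atom_card_eq[OF P(1) Q] by simp
    ultimately have "excess F1 \<le> excess F"
      using cF1 cI[OF Q1(1)] by (simp add: excess_def)
    moreover have dis: "F1 \<inter> R `` F1 = {}"
      using F(2) Q1R Q1Q1 symR unfolding F1_def by blast
    then have "admissible F1"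
      using F' Q1' by (auto simp: admissible_def F1_def)
    ultimately have "fragment F1" using fragmentI[OF F(1)] by blast
    then have "card F1 \<le> n" using n(2)[of "card F1"] dis by blast
    moreover have "card Q > 0" using Q' finite_sub by (auto simp: card_gt_0_iff)
    ultimately show False using cF1 F(3) by simp
  qed
  then have "card V = card F + card (R `` F)"
    using card_Un_disjoint[OF finF F(2)] by simp
  then have "int (card V) = 2 * int (card F) + int (card Q)"
    using ex by (simp add: excess_def)
  then have "card V = 2 * card F + card Q" by linarith
  then show ?thesis using ev by simp
qed

text \<open>Here \<open>a\<close> is the size of an atom \<open>Q\<close>, and N(Q), being a union
  of atoms, has size \<open>Suc d * a\<close>; the least excess is thus \<open>d * a\<close>. As
  N(Q) contains the image of a vertex, \<open>r \<le> Suc d * a\<close>. Sets attaining the bound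
  are fragments, hence unions of atoms. The last three clauses restrict \<open>d = 0\<close> and
  \<open>d = 1\<close>, which would otherwise admit an excess below 4 in the application.\<close>

theorem atom_parameters:
  assumes nbr: "\<And>v. v \<in> V \<Longrightarrow> card (R `` {v}) = r" and "r > 0"
    and S0: "S0 \<subseteq> V" "S0 \<noteq> {}" "R `` S0 \<noteq> V"
  obtains a d where "a > 0" "r \<le> Suc d * a"
    and "\<forall>S \<subseteq> V. S \<noteq> {} \<and> R `` S \<noteq> V \<longrightarrow> d * a + card S \<le> card (R `` S)"
    and "\<forall>S \<subseteq> V. S \<noteq> {} \<and> R `` S \<noteq> V \<and> card (R `` S) = d * a + card S \<longrightarrow> a dvd card S"
    and "d = 0 \<longrightarrow> (\<exists>U W. V = U \<union> W \<and> U \<inter> W = {} \<and> R \<subseteq> U \<times> W \<union> W \<times> U)"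
    and "d = 1 \<longrightarrow> (\<exists>v \<in> V. (v, v) \<notin> R)"
    and "d = 1 \<and> even (card V) \<longrightarrow> even a"
proof -
  have "admissible S0" using S0 by (simp add: admissible_def)
  then obtain Q where Q: "atom Q" by (rule atom_exists)
  then have fQ: "fragment Q" and Q': "Q \<subseteq> V" "Q \<noteq> {}" "R `` Q \<noteq> V"
    using fragment_sub by (auto simp: atom_def)
  have finQ: "finite Q" "finite (R `` Q)" using Q' Image_sub finite_sub by auto
  have nbr0: "R `` {v} \<noteq> {}" if "v \<in> V" for v using nbr[OF that] assms(2) by auto
  obtain v where v: "v \<in> Q" "v \<in> V" using Q' by blast
  have rQ: "r \<le> card (R `` Q)"
    using card_mono[OF finQ(2), of "R `` {v}"] v nbr by auto
  have a0: "card Q > 0" using Q' finQ by (auto simp: card_gt_0_iff)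
  have "card Q dvd card (R `` Q)"
    using atom_Image_union[OF _ fQ] Image_sub by (intro atom_card_dvd[OF Q]) auto
  then obtain m where m: "card (R `` Q) = card Q * m" by blast
  with rQ assms(2) have "m \<noteq> 0" by (intro notI) simp
  then obtain d where d: "m = Suc d" using not0_implies_Suc by blast
  have ex: "excess Q = int (d * card Q)"
    using m d by (simp add: excess_def algebra_simps)
  have cSuc: "card (R `` Q) = Suc d * card Q" using m d by (simp add: algebra_simps)
  show ?thesis
  proof (rule that[of "card Q" d])
    show "card Q > 0" by (rule a0)
    show "r \<le> Suc d * card Q" using rQ cSuc by simp
    show "\<forall>S \<subseteq> V. S \<noteq> {} \<and> R `` S \<noteq> V \<longrightarrow> d * card Q + card S \<le> card (R `` S)"
    proof (intro allI impI)
      fix S assume "S \<subseteq> V" "S \<noteq> {} \<and> R `` S \<noteq> V"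
      then have "excess Q \<le> excess S" using fQ by (auto simp: fragment_def admissible_def)
      then have "int (d * card Q) + int (card S) \<le> int (card (R `` S))"
        using ex by (simp add: excess_def)
      then show "d * card Q + card S \<le> card (R `` S)" by linarith
    qed
    show "\<forall>S \<subseteq> V. S \<noteq> {} \<and> R `` S \<noteq> V \<and> card (R `` S) = d * card Q + card S \<longrightarrow> card Q dvd card S"
    proof (intro allI impI)
      fix S assume S: "S \<subseteq> V" "S \<noteq> {} \<and> R `` S \<noteq> V \<and> card (R `` S) = d * card Q + card S"
      then have "excess S \<le> excess Q" using ex by (simp add: excess_def)
      then have "fragment S" using S fragmentI[OF fQ] by (auto simp: admissible_def)
      then show "card Q dvd card S" using atom_subset_fragment S(1) by (intro atom_card_dvd[OF Q]) auto
    qed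
    show "d = 0 \<longrightarrow> (\<exists>U W. V = U \<union> W \<and> U \<inter> W = {} \<and> R \<subseteq> U \<times> W \<union> W \<times> U)"
      using atom_exact_image[OF nbr0 Q] cSuc by simp
    show "d = 1 \<longrightarrow> (\<exists>v \<in> V. (v, v) \<notin> R)"
      using atom_double_image[OF Q] cSuc v by auto
    show "d = 1 \<and> even (card V) \<longrightarrow> even (card Q)"
      using atom_double_image_even[OF Q] cSuc by simp
  qed
qed

end

section \<open>Edge cuts\<close>

definition arcs_between :: "('a \<times> 'a) set \<Rightarrow> 'a set \<Rightarrow> 'a set \<Rightarrow> nat" where
  "arcs_between R A B = card (R \<inter> A \<times> B)"

lemma arcs_between_commute:
  assumes "sym R"
  shows "arcs_between R A B = arcs_between R B A"
proof -
  have "(R \<inter> A \<times> B)\<inverse> = R \<inter> B \<times> A" using assms by (auto dest: symD)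
  then show ?thesis by (metis arcs_between_def card_inverse)
qed

lemma arcs_between_mono:
  assumes "finite R" "A \<subseteq> A'" "B \<subseteq> B'"
  shows "arcs_between R A B \<le> arcs_between R A' B'"
  unfolding arcs_between_def using assms by (intro card_mono) auto

lemma arcs_between_Un_left:
  assumes "finite R" "A \<inter> A' = {}"
  shows "arcs_between R (A \<union> A') B = arcs_between R A B + arcs_between R A' B"
proof -
  have "R \<inter> (A \<union> A') \<times> B = (R \<inter> A \<times> B) \<union> (R \<inter> A' \<times> B)" by blast
  moreover have "(R \<inter> A \<times> B) \<inter> (R \<inter> A' \<times> B) = {}" using assms(2) by blast
  ultimately show ?thesis
    unfolding arcs_between_def using assms(1) by (simp add: card_Un_disjoint)
qed

lemma arcs_between_Un_right:
  assumes "finite R" "B \<inter> B' = {}"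
  shows "arcs_between R A (B \<union> B') = arcs_between R A B + arcs_between R A B'"
proof -
  have "R \<inter> A \<times> (B \<union> B') = (R \<inter> A \<times> B) \<union> (R \<inter> A \<times> B')" by blast
  moreover have "(R \<inter> A \<times> B) \<inter> (R \<inter> A \<times> B') = {}" using assms(2) by blast
  ultimately show ?thesis
    unfolding arcs_between_def using assms(1) by (simp add: card_Un_disjoint)
qed

lemma arcs_between_Union_left:
  assumes "finite R" "finite F" "disjoint F"
  shows "arcs_between R (\<Union> F) B = (\<Sum>A\<in>F. arcs_between R A B)"
  using assms(2,3)
proof (induction F)
  case empty
  then show ?case by (simp add: arcs_between_def)
next
  case (insert A F)
  then have "A \<inter> \<Union> F = {}" "disjoint F" by (auto simp: disjoint_def)
  then show ?case using insert arcs_between_Un_left[OF assms(1)] by simp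
qed

lemma arcs_between_eq_sum:
  assumes "finite A" "finite R"
  shows "arcs_between R A B = (\<Sum>v\<in>A. card (R `` {v} \<inter> B))"
proof -
  have "R \<inter> A \<times> B = (SIGMA v:A. R `` {v} \<inter> B)" by auto
  moreover have "finite (R `` {v} \<inter> B)" for v using assms(2) by (simp add: finite_Image)
  ultimately show ?thesis unfolding arcs_between_def using assms(1) by simp
qed

lemma even_arcs_within:
  assumes "finite A" "finite R" "sym R" "irrefl R"
  shows "even (arcs_between R A A)"
  using assms(1)
proof (induction A)
  case empty
  then show ?case by (simp add: arcs_between_def)
next
  case (insert x A)
  have "arcs_between R {x} {x} = 0"
    using assms(4) by (auto simp: arcs_between_def irrefl_def)
  moreover have "arcs_between R (insert x A) (insert x A) =
      arcs_between R {x} {x} + arcs_between R {x} A + (arcs_between R A {x} + arcs_between R A A)"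
    using arcs_between_Un_left[OF assms(2), of "{x}" A "insert x A"]
      arcs_between_Un_right[OF assms(2), of "{x}" A] insert(2) by simp
  ultimately show ?case
    using insert arcs_between_commute[OF assms(3), of A "{x}"] by simp
qed

definition triangle_free :: "('a \<times> 'a) set \<Rightarrow> bool" where
  "triangle_free R \<longleftrightarrow> (\<forall>u v w. (u, v) \<in> R \<longrightarrow> (v, w) \<in> R \<longrightarrow> (u, w) \<notin> R)"

text \<open>Ordered pairs are counted, so this is Mantel's bound \<open>n\<^sup>2 / 4\<close> on the number of edges.\<close>

lemma mantel:
  assumes "finite A" "finite R" "sym R" "irrefl R"
    and tf: "triangle_free R"
  shows "2 * arcs_between R A A \<le> card A ^ 2"
  using assms(1)
proof (induction "card A" arbitrary: A rule: less_induct)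
  case less
  show ?case
  proof (cases "R \<inter> A \<times> A = {}")
    case True
    then show ?thesis by (simp add: arcs_between_def)
  next
    case False
    then obtain u v where uv: "(u, v) \<in> R" "u \<in> A" "v \<in> A" by blast
    then have ne: "u \<noteq> v" using assms(4) by (auto simp: irrefl_def)
    define B where "B = A - {u, v}"
    have A: "A = {u, v} \<union> B" "{u, v} \<inter> B = {}" using uv by (auto simp: B_def)
    have finB: "finite B" using less.prems by (simp add: B_def)
    have cA: "card A = card B + 2"
      unfolding A(1) using A(2) ne finB by (subst card_Un_disjoint) auto
    have IH: "2 * arcs_between R B B \<le> card B ^ 2"
      using less.hyps[of B] cA finB by simp
    have "arcs_between R {u, v} B = (\<Sum>w\<in>{u, v}. card (R `` {w} \<inter> B))"
      by (rule arcs_between_eq_sum) (use assms in auto)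
    also have "\<dots> = card (R `` {u} \<inter> B) + card (R `` {v} \<inter> B)" using ne by simp
    \<comment> \<open>Adjacent vertices of a triangle-free graph have disjoint
      neighbourhoods.\<close>
    also have "\<dots> = card ((R `` {u} \<inter> B) \<union> (R `` {v} \<inter> B))"
      using tf uv finB by (intro card_Un_disjoint[symmetric]) (auto simp: triangle_free_def)
    also have "\<dots> \<le> card B" using finB by (intro card_mono) auto
    finally have uB: "arcs_between R {u, v} B \<le> card B" .
    have "arcs_between R {u, v} {u, v} \<le> card {(u, v), (v, u)}"
      unfolding arcs_between_def using assms(4) by (intro card_mono) (auto simp: irrefl_def)
    then have uu: "arcs_between R {u, v} {u, v} \<le> 2" by (simp add: card_insert_if split: if_splits)
    have "arcs_between R A A = arcs_between R {u, v} {u, v} + arcs_between R {u, v} B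
        + (arcs_between R B {u, v} + arcs_between R B B)"
      unfolding A(1)
      using arcs_between_Un_left[OF assms(2) A(2)] arcs_between_Un_right[OF assms(2) A(2)] by simp
    then show ?thesis
      using IH uB uu cA arcs_between_commute[OF assms(3), of B "{u, v}"]
      by (simp add: power2_eq_square)
  qed
qed

section \<open>Cuts in a regular vertex-transitive graph\<close>

locale transitive_graph = transitive_relation V E
  for V :: "'a set" and E :: "('a \<times> 'a) set" +
  fixes k :: nat
  assumes irrefl: "irrefl E"
    and regular: "v \<in> V \<Longrightarrow> card (E `` {v}) = k"
begin

abbreviation "ab \<equiv> arcs_between E"

definition cut :: "'a set \<Rightarrow> nat" where
  "cut A = ab A (V - A)"

lemma finite_E: "finite E"
  using R_sub finite_V finite_subset by blast

lemmas ab_commute = arcs_between_commute[OF R_sym]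
lemmas ab_mono = arcs_between_mono[OF finite_E]
lemmas ab_Un_left = arcs_between_Un_left[OF finite_E]
lemmas ab_Un_right = arcs_between_Un_right[OF finite_E]

lemma ab_V:
  assumes "A \<subseteq> V"
  shows "ab A V = k * card A"
proof -
  have "ab A V = (\<Sum>v\<in>A. card (E `` {v} \<inter> V))"
    using assms finite_sub finite_E by (intro arcs_between_eq_sum)
  also have "\<dots> = (\<Sum>v\<in>A. k)"
  proof (rule sum.cong[OF refl])
    fix v assume "v \<in> A"
    moreover have "E `` {v} \<inter> V = E `` {v}" using Image_sub by blast
    ultimately show "card (E `` {v} \<inter> V) = k" using regular assms by auto
  qed
  finally show ?thesis by simp
qed

lemma cut_add_inner:
  assumes "A \<subseteq> V"
  shows "cut A + ab A A = k * card A"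
proof -
  have "V = (V - A) \<union> A" using assms by blast
  then have "ab A V = ab A (V - A) + ab A A"
    using ab_Un_right[of "V - A" A A] by (metis Diff_disjoint inf_commute)
  then show ?thesis using ab_V[OF assms] by (simp add: cut_def)
qed

lemma cut_parity:
  assumes "A \<subseteq> V"
  shows "even (cut A) \<longleftrightarrow> even (k * card A)"
  using cut_add_inner[OF assms] even_arcs_within[OF finite_sub[OF assms] finite_E R_sym irrefl]
  by (metis even_add)

lemma cut_compl: "A \<subseteq> V \<Longrightarrow> cut (V - A) = cut A"
  unfolding cut_def by (subst ab_commute) (simp add: double_diff)

text \<open>Written in terms of the four parts, both uncrossing inequalities become linear
  arithmetic: the submodular one loses twice the arcs from \<open>A - B\<close> to
  \<open>B - A\<close>, the posimodular one twice those from \<open>A \<inter> B\<close> to the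
  outside of \<open>A \<union> B\<close>.\<close>

lemma cut_four_parts:
  assumes "A \<subseteq> V" "B \<subseteq> V"
  defines "K \<equiv> A \<inter> B" and "L \<equiv> B - A" and "M \<equiv> A - B" and "N \<equiv> V - (A \<union> B)"
  shows "cut A = ab K L + ab K N + ab M L + ab M N"
    and "cut B = ab K M + ab K N + ab L M + ab L N"
    and "cut K = ab K L + ab K M + ab K N"
    and "cut (A \<union> B) = ab K N + ab L N + ab M N"
    and "cut M = ab M K + ab M L + ab M N"
    and "cut L = ab L K + ab L M + ab L N"
proof -
  have d: "K \<inter> L = {}" "K \<inter> M = {}" "K \<inter> N = {}" "L \<inter> M = {}" "L \<inter> N = {}" "M \<inter> N = {}"
    by (auto simp: K_def L_def M_def N_def)
  have eqs: "A = K \<union> M" "V - A = L \<union> N" "B = K \<union> L" "V - B = M \<union> N"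
    "V - K = (L \<union> M) \<union> N" "A \<union> B = (K \<union> L) \<union> M" "V - (A \<union> B) = N"
    "V - M = (K \<union> L) \<union> N" "V - L = (K \<union> M) \<union> N"
    using assms(1,2) by (auto simp: K_def L_def M_def N_def)
  have d3: "(L \<union> M) \<inter> N = {}" "(K \<union> L) \<inter> M = {}" "(K \<union> L) \<inter> N = {}" "(K \<union> M) \<inter> N = {}"
    using d by blast+
  show "cut A = ab K L + ab K N + ab M L + ab M N"
    unfolding cut_def eqs(2) unfolding eqs(1) by (simp only: ab_Un_left[OF d(2)] ab_Un_left[OF d(1)] ab_Un_right[OF d(5)] ab_Un_right[OF d(6)])
  show "cut B = ab K M + ab K N + ab L M + ab L N"
    unfolding cut_def eqs(4) unfolding eqs(3) by (simp only: ab_Un_left[OF d(2)] ab_Un_left[OF d(1)] ab_Un_right[OF d(5)] ab_Un_right[OF d(6)])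
  show "cut K = ab K L + ab K M + ab K N"
    unfolding cut_def eqs(5) by (simp only: ab_Un_right[OF d3(1)] ab_Un_right[OF d(4)])
  show "cut (A \<union> B) = ab K N + ab L N + ab M N"
    unfolding cut_def eqs(7) unfolding eqs(6) by (simp only: ab_Un_left[OF d3(2)] ab_Un_left[OF d(1)])
  show "cut M = ab M K + ab M L + ab M N"
    unfolding cut_def eqs(8) by (simp only: ab_Un_right[OF d3(3)] ab_Un_right[OF d(1)])
  show "cut L = ab L K + ab L M + ab L N"
    unfolding cut_def eqs(9) by (simp only: ab_Un_right[OF d3(4)] ab_Un_right[OF d(2)])
qed

lemma cut_submodular:
  assumes "A \<subseteq> V" "B \<subseteq> V"
  shows "cut (A \<inter> B) + cut (A \<union> B) \<le> cut A + cut B"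
  using cut_four_parts[OF assms] ab_commute[of "A - B" "B - A"] by linarith

lemma cut_posimodular:
  assumes "A \<subseteq> V" "B \<subseteq> V"
  shows "cut (A - B) + cut (B - A) \<le> cut A + cut B"
  using cut_four_parts[OF assms] ab_commute[of "A - B" "A \<inter> B"] ab_commute[of "B - A" "A \<inter> B"]
    ab_commute[of "B - A" "A - B"] by linarith

lemma ab_within_le: "A \<subseteq> V \<Longrightarrow> ab A A \<le> card A * (card A - 1)"
proof -
  assume A: "A \<subseteq> V"
  have "ab A A = (\<Sum>v\<in>A. card (E `` {v} \<inter> A))"
    using A finite_sub finite_E by (intro arcs_between_eq_sum)
  also have "\<dots> \<le> (\<Sum>v\<in>A. card A - 1)"
  proof (rule sum_mono)
    fix v assume "v \<in> A"
    have "card (E `` {v} \<inter> A) \<le> card (A - {v})"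
      using irrefl finite_sub[OF A] by (intro card_mono) (auto simp: irrefl_def)
    then show "card (E `` {v} \<inter> A) \<le> card A - 1" using \<open>v \<in> A\<close> by simp
  qed
  finally show ?thesis by simp
qed

text \<open>Each vertex of \<open>A\<close> has at most \<open>card A - 1\<close> neighbours inside
  \<open>A\<close>. Integers are used because \<open>card A\<close> may exceed
  \<open>k + 1\<close>.\<close>

lemma cut_ge: "A \<subseteq> V \<Longrightarrow> int (card A) * (int k + 1 - int (card A)) \<le> int (cut A)"
proof -
  assume A: "A \<subseteq> V"
  have "int (ab A A) \<le> int (card A) * (int (card A) - 1)"
  proof (cases "card A")
    case 0
    then show ?thesis using ab_within_le[OF A] by simp
  next
    case (Suc n)
    have "int (ab A A) \<le> int (card A * (card A - 1))" using ab_within_le[OF A] by linarith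
    then show ?thesis using Suc by (simp add: algebra_simps)
  qed
  moreover have "int (cut A) + int (ab A A) = int k * int (card A)"
    using cut_add_inner[OF A] by (metis of_nat_add of_nat_mult)
  ultimately show ?thesis by (simp add: algebra_simps)
qed

lemma automorphism_ab:
  assumes f: "rel_automorphism V E f" and "A \<subseteq> V" "B \<subseteq> V"
  shows "ab (f ` A) (f ` B) = ab A B"
proof -
  have inj: "inj_on f V" and fe: "\<And>u v. u \<in> V \<Longrightarrow> v \<in> V \<Longrightarrow> (f u, f v) \<in> E \<longleftrightarrow> (u, v) \<in> E"
    using f by (auto simp: rel_automorphism_def bij_betw_def)
  have "E \<inter> f ` A \<times> f ` B = map_prod f f ` (E \<inter> A \<times> B)"
  proof
    show "E \<inter> f ` A \<times> f ` B \<subseteq> map_prod f f ` (E \<inter> A \<times> B)"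
    proof
      fix z assume "z \<in> E \<inter> f ` A \<times> f ` B"
      then obtain a b where "a \<in> A" "b \<in> B" "z = (f a, f b)" "(f a, f b) \<in> E" by auto
      then show "z \<in> map_prod f f ` (E \<inter> A \<times> B)" using fe assms by force
    qed
    show "map_prod f f ` (E \<inter> A \<times> B) \<subseteq> E \<inter> f ` A \<times> f ` B"
      using fe assms by (auto simp: subset_iff)
  qed
  moreover have "inj_on (map_prod f f) (E \<inter> A \<times> B)"
    using inj assms by (auto simp: inj_on_def map_prod_def)
  ultimately show ?thesis unfolding arcs_between_def by (simp add: card_image)
qed

lemma automorphism_cut:
  assumes f: "rel_automorphism V E f" and "A \<subseteq> V"
  shows "cut (f ` A) = cut A"
proof -
  have "f ` (V - A) = V - f ` A"
    using f assms(2) by (metis bij_betw_def inj_on_image_set_diff Diff_subset rel_automorphism_def)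
  then show ?thesis using automorphism_ab[OF f assms(2), of "V - A"] by (simp add: cut_def)
qed

section \<open>Atoms of minimum cuts with both sides of bounded size\<close>

definition splits :: "nat \<Rightarrow> 'a set \<Rightarrow> bool" where
  "splits s A \<longleftrightarrow> A \<subseteq> V \<and> s \<le> card A \<and> s \<le> card (V - A)"

lemma splits_compl: "splits s A \<Longrightarrow> splits s (V - A)"
  by (auto simp: splits_def double_diff)

definition cut_atom :: "nat \<Rightarrow> 'a set \<Rightarrow> bool" where
  "cut_atom s A \<longleftrightarrow> splits s A \<and> (\<forall>B. splits s B \<longrightarrow> cut A < cut B \<or> cut A = cut B \<and> card A \<le> card B)"

lemma cut_atom_exists:
  assumes "splits s C"
  obtains A where "cut_atom s A"
proof -
  define P where "P n \<longleftrightarrow> (\<exists>A. splits s A \<and> cut A = n)" for n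
  have "P (cut C)" using assms by (auto simp: P_def)
  then have "P (LEAST n. P n)" by (rule LeastI)
  then obtain A0 where A0: "splits s A0" "cut A0 = (LEAST n. P n)" by (auto simp: P_def)
  have min: "cut A0 \<le> cut B" if "splits s B" for B
    unfolding A0(2) using that by (intro Least_le) (auto simp: P_def)
  define Q where "Q n \<longleftrightarrow> (\<exists>A. splits s A \<and> cut A = cut A0 \<and> card A = n)" for n
  have "Q (card A0)" using A0 by (auto simp: Q_def)
  then have "Q (LEAST n. Q n)" by (rule LeastI)
  then obtain A where A: "splits s A" "cut A = cut A0" "card A = (LEAST n. Q n)" by (auto simp: Q_def)
  have "card A \<le> card B" if "splits s B" "cut B = cut A0" for B
    unfolding A(3) using that by (intro Least_le) (auto simp: Q_def)
  then have "cut_atom s A"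
    unfolding cut_atom_def using A min by (metis le_eq_less_or_eq)
  then show ?thesis by (rule that)
qed

lemma cut_atom_le: "cut_atom s A \<Longrightarrow> splits s B \<Longrightarrow> cut A \<le> cut B"
  by (auto simp: cut_atom_def)

lemma cut_atom_card_le: "cut_atom s A \<Longrightarrow> splits s B \<Longrightarrow> cut B \<le> cut A \<Longrightarrow> card A \<le> card B"
  by (auto simp: cut_atom_def)

lemma cut_atom_same:
  assumes A: "cut_atom s A" and B: "cut_atom s B"
  shows "cut A = cut B" and "card A = card B"
proof -
  have s: "splits s A" "splits s B" using A B by (simp_all add: cut_atom_def)
  show "cut A = cut B" using cut_atom_le[OF A s(2)] cut_atom_le[OF B s(1)] by simp
  then show "card A = card B"
    using cut_atom_card_le[OF A s(2)] cut_atom_card_le[OF B s(1)] by simp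
qed

lemma cut_atom_half:
  assumes "cut_atom s A"
  shows "2 * card A \<le> card V"
proof -
  have A: "splits s A" "A \<subseteq> V" using assms by (auto simp: cut_atom_def splits_def)
  have "card A \<le> card (V - A)"
    using cut_atom_card_le[OF assms splits_compl[OF A(1)]] cut_compl[OF A(2)] by simp
  then show ?thesis using A(2) finite_V by (simp add: card_Diff_subset finite_sub)
qed

lemma cut_atom_image:
  assumes f: "rel_automorphism V E f" and A: "cut_atom s A"
  shows "cut_atom s (f ` A)"
proof -
  have sA: "splits s A" "A \<subseteq> V" using A by (auto simp: cut_atom_def splits_def)
  have "card (f ` A) = card A" by (rule automorphism_card[OF f sA(2)])
  moreover have "f ` A \<subseteq> V" by (rule automorphism_range[OF f sA(2)])
  moreover have "card (V - f ` A) = card (V - A)"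
    using calculation sA(2) finite_V by (simp add: card_Diff_subset finite_sub)
  ultimately show ?thesis
    using A sA automorphism_cut[OF f sA(2)] by (simp add: cut_atom_def splits_def)
qed

text \<open>For two crossing atoms, either the intersection or both differences have at least
  \<open>s\<close> vertices, by \<open>2 * s \<le> card A + 1\<close>. Submodularity or
  posimodularity then gives a smaller set whose cut is no larger.\<close>

lemma cut_atom_eq:
  assumes A: "cut_atom s A" and B: "cut_atom s B" and large: "2 * s \<le> card A + 1" and AB: "A \<inter> B \<noteq> {}"
  shows "A = B"
proof (rule ccontr)
  assume ne: "A \<noteq> B"
  have sA: "splits s A" "A \<subseteq> V" and sB: "splits s B" "B \<subseteq> V"
    using A B by (auto simp: cut_atom_def splits_def)
  have fin: "finite A" "finite B" using sA sB finite_sub by auto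
  have eq: "cut A = cut B" "card A = card B"
    using cut_atom_same[OF A B] by simp_all
  have "A \<inter> B \<noteq> A" using ne eq fin by (metis card_subset_eq inf.absorb_iff1)
  then have lt: "card (A \<inter> B) < card A" using fin by (intro psubset_card_mono) auto
  have pos: "card (A \<inter> B) > 0" using AB fin by (auto simp: card_gt_0_iff)
  have cu: "card (A \<union> B) + card (A \<inter> B) = 2 * card A" using card_Un_Int[OF fin] eq by simp
  have cd: "card (A - B) = card A - card (A \<inter> B)" "card (B - A) = card A - card (A \<inter> B)"
    using fin eq by (auto simp: card_Diff_subset_Int Int_commute)
  have compl: "card (V - X) = card V - card X" if "X \<subseteq> V" for X
    using that finite_V by (simp add: card_Diff_subset finite_sub)
  show False
  proof (cases "s \<le> card (A \<inter> B)")
    case True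
    have s1: "splits s (A \<inter> B)"
      using True sA sB compl[of A] compl[of "A \<inter> B"] lt le_infI1[OF sA(2), of B]
      unfolding splits_def by linarith
    \<comment> \<open>An atom is at most half of \<open>V\<close>, so the complement of the union is
      at least as large as the intersection.\<close>
    have "s \<le> card (V - (A \<union> B))"
      using True cut_atom_half[OF A] cu compl[of "A \<union> B"] sA sB by simp
    moreover have "card A \<le> card (A \<union> B)" using fin by (intro card_mono) auto
    ultimately have s2: "splits s (A \<union> B)" using sA sB by (auto simp: splits_def)
    have "cut (A \<inter> B) \<le> cut A"
      using cut_submodular[OF sA(2) sB(2)] cut_atom_le[OF A s2] eq by simp
    then show ?thesis using cut_atom_card_le[OF A s1] lt by simp
  next
    case False
    have "A - B \<subseteq> V" "B - A \<subseteq> V" using sA sB by auto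
    then have s1: "splits s (A - B)" and s2: "splits s (B - A)"
      using False large cd sA sB compl[of A] compl[of B] compl[of "A - B"] compl[of "B - A"]
      by (auto simp: splits_def)
    have "cut (A - B) \<le> cut A"
      using cut_posimodular[OF sA(2) sB(2)] cut_atom_le[OF A s2] eq by simp
    then show ?thesis using cut_atom_card_le[OF A s1] cd pos lt by simp
  qed
qed

text \<open>An automorphism moving one vertex of the atom to another maps the atom onto itself, by
  \<open>cut_atom_eq\<close>. The induced subgraph is therefore vertex-transitive, in particular
  regular.\<close>

lemma cut_atom_regular:
  assumes A: "cut_atom s A" and large: "2 * s \<le> card A + 1" and ne: "A \<noteq> {}"
  obtains r where "\<And>v. v \<in> A \<Longrightarrow> card (E `` {v} \<inter> A) = r" and "r < card A" "r \<le> k"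
    and "cut A = card A * (k - r)"
proof -
  have sA: "A \<subseteq> V" using A by (auto simp: cut_atom_def splits_def)
  have finA: "finite A" using sA finite_sub by auto
  obtain u where u: "u \<in> A" using ne by blast
  define r where "r = card (E `` {u} \<inter> A)"
  have reg: "card (E `` {v} \<inter> A) = r" if v: "v \<in> A" for v
  proof -
    obtain f where f: "rel_automorphism V E f" "f u = v" using transitive u v sA by blast
    have "f ` A = A"
      using cut_atom_eq[OF cut_atom_image[OF f(1) A] A] large f u v automorphism_card[OF f(1) sA] by auto
    then have "ab {v} A = ab {u} A"
      using automorphism_ab[OF f(1), of "{u}" A] u sA f(2) by auto
    then show ?thesis
      using arcs_between_eq_sum[OF _ finite_E, of "{v}" A] arcs_between_eq_sum[OF _ finite_E, of "{u}" A]
      by (simp add: r_def)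
  qed
  have "E `` {u} \<inter> A \<subset> A" using u irrefl by (auto simp: irrefl_def)
  then have "r < card A" unfolding r_def using finA psubset_card_mono by blast
  have "finite (E `` {u})" using Image_sub finite_sub by blast
  then have "r \<le> card (E `` {u})" unfolding r_def by (intro card_mono) auto
  then have "r \<le> k" using regular u sA by auto
  have "ab A A = card A * r"
    using arcs_between_eq_sum[OF finA finite_E, of A] reg by simp
  then have "cut A = card A * (k - r)"
    using cut_add_inner[OF sA] by (simp add: diff_mult_distrib2 mult.commute)
  then show ?thesis using that reg \<open>r < card A\<close> \<open>r \<le> k\<close> by blast
qed

lemma cut_pos:
  assumes "A \<subseteq> V" "A \<noteq> {}" "A \<noteq> V"
  shows "cut A > 0"
proof -
  have "\<not> E `` A \<subseteq> A" using connected assms by blast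
  then obtain x y where "x \<in> A" "y \<in> V - A" "(x, y) \<in> E" using R_sub by blast
  then have "E \<inter> A \<times> (V - A) \<noteq> {}" by blast
  then show ?thesis unfolding cut_def arcs_between_def using finite_E by (simp add: card_gt_0_iff)
qed

text \<open>An atom for \<open>s = 1\<close> with inner degree \<open>r < k\<close> has more than
  \<open>r\<close> vertices, so its cut is at least \<open>(r + 1) * (k - r)\<close>, and this is at
  least \<open>k\<close>.\<close>

theorem edge_connectivity:
  assumes "A \<subseteq> V" "A \<noteq> {}" "A \<noteq> V"
  shows "k \<le> cut A"
proof -
  have sA: "splits 1 A"
    using assms finite_V finite_sub by (auto simp: splits_def Suc_le_eq card_gt_0_iff)
  obtain B where B: "cut_atom 1 B" by (rule cut_atom_exists[OF sA])
  then have sB: "splits 1 B" by (simp add: cut_atom_def)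
  then have B': "B \<subseteq> V" "B \<noteq> {}" "B \<noteq> V" by (auto simp: splits_def)
  obtain r where r: "r < card B" "r \<le> k" "cut B = card B * (k - r)"
  proof (rule cut_atom_regular[OF B _ B'(2)])
    show "2 * 1 \<le> card B + 1" using sB by (simp add: splits_def)
  qed
  have "r \<noteq> k" using cut_pos[OF B'] r by auto
  then obtain j where j: "k = Suc (r + j)" using r(2) by (metis le_neq_implies_less less_imp_Suc_add)
  have "Suc r * Suc j \<le> card B * Suc j" using r(1) by (intro mult_right_mono) auto
  then have "k \<le> cut B" using r(3) j by simp
  then show ?thesis using cut_atom_le[OF B sA] by simp
qed

end

section \<open>Barriers of deficiency two\<close>

context transitive_graph
begin

text \<open>Each vertex of \<open>K\<close> has one neighbour outside \<open>B\<close>. A vertex of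
  \<open>B - K\<close> has \<open>k - 1\<close> neighbours in \<open>B\<close>, at most
  \<open>card (B - K) - 1\<close> of them outside \<open>K\<close>, hence at least
  \<open>k - card (B - K)\<close> in \<open>K\<close>.\<close>

lemma block_subset_cut:
  assumes B: "B \<subseteq> V" and reg: "\<And>v. v \<in> B \<Longrightarrow> card (E `` {v} \<inter> B) + 1 = k" and K: "K \<subseteq> B"
  shows "int (card K) + int (card (B - K)) * (int k - int (card (B - K))) \<le> int (cut K)"
proof -
  define L where "L = B - K"
  have sub: "K \<subseteq> V" "L \<subseteq> V" "L \<subseteq> B" using B K by (auto simp: L_def)
  have inB: "int (ab S B) = int (card S) * (int k - 1)" if S: "S \<subseteq> B" for S
  proof -
    have "ab S B = (\<Sum>v\<in>S. card (E `` {v} \<inter> B))"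
      using S B finite_sub finite_E by (intro arcs_between_eq_sum) auto
    also have "int \<dots> = (\<Sum>v\<in>S. int k - 1)"
      unfolding of_nat_sum
    proof (rule sum.cong[OF refl])
      fix v assume "v \<in> S"
      then show "int (card (E `` {v} \<inter> B)) = int k - 1" using reg[of v] S by force
    qed
    finally show ?thesis by simp
  qed
  have "ab L L \<le> card L * (card L - 1)" by (rule ab_within_le[OF sub(2)])
  then have "int (ab L L) \<le> int (card L * (card L - 1))" by linarith
  also have "\<dots> = int (card L) * (int (card L) - 1)" by (cases "card L") (auto simp: algebra_simps)
  finally have LL: "int (ab L L) \<le> int (card L) * (int (card L) - 1)" .
  have "ab L (K \<union> L) = ab L K + ab L L" by (rule ab_Un_right) (auto simp: L_def)
  moreover have "K \<union> L = B" using K by (auto simp: L_def)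
  ultimately have KL: "int (ab L K) = int (card L) * (int k - 1) - int (ab L L)"
    using inB[OF sub(3)] by simp
  have "ab K (B \<union> (V - B)) = ab K B + ab K (V - B)" by (rule ab_Un_right) auto
  moreover have "B \<union> (V - B) = V" using B by auto
  ultimately have "ab K B + ab K (V - B) = k * card K" using ab_V[OF sub(1)] by simp
  then have "int (ab K B) + int (ab K (V - B)) = int k * int (card K)"
    by (metis of_nat_add of_nat_mult)
  then have out: "int (ab K (V - B)) = int (card K)" using inB[OF K] by (simp add: algebra_simps)
  have "V - K = L \<union> (V - B)" using B K by (auto simp: L_def)
  then have "cut K = ab K L + ab K (V - B)"
    unfolding cut_def using ab_Un_right[of L "V - B" K] by (auto simp: L_def)
  moreover have "ab K L = ab L K" by (rule ab_commute)
  ultimately have "int (cut K) = int (card K) + int (card L) * (int k - 1) - int (ab L L)"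
    using KL out by simp
  then show ?thesis using LL unfolding L_def[symmetric] by (simp add: algebra_simps)
qed

lemma triangle_free_cut:
  assumes "triangle_free E" and S: "S \<subseteq> V"
  shows "2 * k * card S \<le> 2 * cut S + card S ^ 2"
  using mantel[OF finite_sub[OF S] finite_E R_sym irrefl assms(1)] cut_add_inner[OF S] by auto

end

locale graph_barrier = transitive_graph V E k
  for V :: "'a set" and E :: "('a \<times> 'a) set" and k :: nat +
  fixes X :: "'a set" and F :: "'a set set"
  assumes barrier: "odd_barrier E V X F"
    and X_ge: "4 \<le> card X"
    and F_ge: "card X \<le> card F + 2"
begin

lemma X_sub: "X \<subseteq> V" and F_disjoint: "disjoint F"
  and F_sub: "C \<in> F \<Longrightarrow> C \<subseteq> V - X" and F_odd: "C \<in> F \<Longrightarrow> odd (card C)"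
  using barrier by (auto simp: odd_barrier_def)

lemma F_Image: "C \<in> F \<Longrightarrow> E `` C \<subseteq> C \<union> X"
proof -
  assume "C \<in> F"
  then have "E `` C \<inter> V \<subseteq> C \<union> X" using barrier by (simp add: odd_barrier_def)
  then show ?thesis using Image_sub[of C] by blast
qed

lemma Union_F_sub: "\<Union> F \<subseteq> V"
  using F_sub by blast

lemma finite_F: "finite F"
  using finite_UnionD[OF finite_sub[OF Union_F_sub]] .

lemma F_nonempty: "C \<in> F \<Longrightarrow> C \<noteq> {}"
  using F_odd by fastforce

lemma F_ne_V: "C \<in> F \<Longrightarrow> C \<noteq> V"
  using F_sub[of C] X_sub X_ge by (cases "X = {}") auto

lemma F_compl_card: "C \<in> F \<Longrightarrow> 4 \<le> card (V - C)"
proof -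
  assume "C \<in> F"
  then have "X \<subseteq> V - C" using F_sub X_sub by blast
  then have "card X \<le> card (V - C)" using finite_V by (intro card_mono) auto
  then show ?thesis using X_ge by simp
qed

text \<open>Stated for a regular symmetric part \<open>S\<close> of \<open>E\<close> because it
  serves twice: for \<open>E\<close> itself and for the matching formed by the arcs that leave the
  blocks.\<close>

lemma sum_arcs_to_X:
  assumes "sym S" "S \<subseteq> E" and deg: "\<And>v. v \<in> V \<Longrightarrow> card (S `` {v}) = d"
  shows "(\<Sum>C\<in>F. arcs_between S C X) + arcs_between S X X \<le> d * card X"
proof -
  have finS: "finite S" using assms(2) finite_E finite_subset by blast
  have SV: "S \<subseteq> V \<times> V" using assms(2) R_sub by blast
  have "(\<Sum>C\<in>F. arcs_between S C X) = arcs_between S (\<Union> F) X"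
    by (rule arcs_between_Union_left[symmetric, OF finS finite_F F_disjoint])
  also have "\<dots> = arcs_between S X (\<Union> F)" by (rule arcs_between_commute[OF assms(1)])
  finally have "(\<Sum>C\<in>F. arcs_between S C X) + arcs_between S X X = arcs_between S X (\<Union> F \<union> X)"
    using F_sub by (subst arcs_between_Un_right[OF finS]) auto
  also have "\<dots> \<le> arcs_between S X V"
    using Union_F_sub X_sub by (intro arcs_between_mono[OF finS]) auto
  also have "\<dots> = (\<Sum>v\<in>X. card (S `` {v} \<inter> V))"
    by (rule arcs_between_eq_sum[OF finite_sub[OF X_sub] finS])
  also have "\<dots> = (\<Sum>v\<in>X. d)"
  proof (rule sum.cong[OF refl])
    fix v assume "v \<in> X"
    moreover have "S `` {v} \<inter> V = S `` {v}" using SV by blast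
    ultimately show "card (S `` {v} \<inter> V) = d" using deg X_sub by auto
  qed
  finally show ?thesis by (simp add: mult.commute)
qed

lemma F_cut: "C \<in> F \<Longrightarrow> cut C = ab C X"
proof -
  assume C: "C \<in> F"
  have "E \<inter> C \<times> (V - C) = E \<inter> C \<times> X" using F_Image[OF C] F_sub[OF C] X_sub by blast
  then show ?thesis by (simp add: cut_def arcs_between_def)
qed

lemma sum_cuts: "(\<Sum>C\<in>F. cut C) + ab X X \<le> k * card X"
  using sum_arcs_to_X[OF R_sym subset_refl regular] F_cut by simp

text \<open>
  If a member has a small cut, the atoms of minimum cut are imprimitivity blocks with exactly one
  arc leaving the block at each vertex. The members of \<open>F\<close> being odd, each sends such an outer arc
  to \<open>X\<close>, and \<open>X\<close> has only \<open>card X \<le> card F + 2\<close> outer arcs, so none is a union of blocks.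
  A member cutting through a block is uncrossed with it.
\<close>

theorem barrier_large_cut:
  assumes small: "\<And>S. S \<subseteq> V \<Longrightarrow> s \<le> card S \<Longrightarrow> card S + 2 \<le> 2 * s \<Longrightarrow> c \<le> cut S"
    and block: "\<And>n r. 2 * s \<le> n + 1 \<Longrightarrow> r < n \<Longrightarrow> r < k \<Longrightarrow> n * (k - r) < c \<Longrightarrow> r + 1 = k \<and> 5 \<le> n"
    and part: "\<And>B K. B \<subseteq> V \<Longrightarrow> (\<And>v. v \<in> B \<Longrightarrow> card (E `` {v} \<inter> B) + 1 = k) \<Longrightarrow>
      card B < c \<Longrightarrow> K \<subset> B \<Longrightarrow> s \<le> card K \<Longrightarrow> c \<le> cut K"
    and s: "0 < s" "s \<le> 4" and C: "C \<in> F" "s \<le> card C"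
  shows "c \<le> cut C"
proof (rule ccontr)
  assume "\<not> c \<le> cut C"
  then have lt: "cut C < c" by simp
  have CV: "C \<subseteq> V" using F_sub[OF C(1)] by blast
  have sC: "splits s C" using C F_compl_card[OF C(1)] s CV by (simp add: splits_def)
  obtain A where A: "cut_atom s A" by (rule cut_atom_exists[OF sC])
  have Ac: "cut A < c" using cut_atom_le[OF A sC] lt by simp
  have sub: "B \<subseteq> V" "s \<le> card B" "s \<le> card (V - B)" if "cut_atom s B" for B
    using that by (auto simp: cut_atom_def splits_def)
  have eqA: "cut B = cut A" "card B = card A" if B: "cut_atom s B" for B
    using cut_atom_same[OF A B] by simp_all
  \<comment> \<open>Sets with \<open>s\<close> to \<open>2 * s - 2\<close> vertices have cut at
    least \<open>c\<close> by \<open>small\<close>; an atom has a smaller cut, so it is large enough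
    for \<open>cut_atom_eq\<close>.\<close>
  have large: "2 * s \<le> card B + 1" if B: "cut_atom s B" for B
  proof (rule ccontr)
    assume "\<not> ?thesis"
    then have "c \<le> cut B" using small[OF sub(1,2)[OF B]] by linarith
    then show False using Ac eqA[OF B] by simp
  qed
  have blk: "card (E `` {v} \<inter> B) + 1 = k \<and> cut A = card A \<and> 5 \<le> card A" if B: "cut_atom s B" "v \<in> B" for B v
  proof -
    have ne: "B \<noteq> {}" using B by blast
    have neV: "B \<noteq> V" using sub(3)[OF B(1)] s by auto
    obtain r where r: "\<And>v. v \<in> B \<Longrightarrow> card (E `` {v} \<inter> B) = r" "r < card B" "r \<le> k"
      "cut B = card B * (k - r)"
      by (rule cut_atom_regular[OF B(1) large[OF B(1)] ne]) blast
    have "r \<noteq> k" using cut_pos[OF sub(1)[OF B(1)] ne neV] r(4) by auto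
    then have "r + 1 = k \<and> 5 \<le> card B"
      using block[OF large[OF B(1)] r(2)] r(3,4) eqA[OF B(1)] Ac by simp
    then show ?thesis using r(1)[OF B(2)] r(4) eqA[OF B(1)] by (auto simp: Suc_diff_le[symmetric])
  qed
  have ex: "\<exists>B. cut_atom s B \<and> v \<in> B" if v: "v \<in> V" for v
  proof -
    have "A \<noteq> {}" using sub(2)[OF A] s by auto
    then obtain u where u: "u \<in> A" "u \<in> V" using sub(1)[OF A] by blast
    then obtain f where f: "rel_automorphism V E f" "f u = v" using transitive v by blast
    then show ?thesis using cut_atom_image[OF f(1) A] u by blast
  qed
  have uniq: "B = B'" if "cut_atom s B" "cut_atom s B'" "v \<in> B" "v \<in> B'" for B B' v
    using cut_atom_eq[OF that(1,2) large[OF that(1)]] that(3,4) by blast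
  obtain u where "u \<in> A" using sub(2)[OF A] s by fastforce
  then have m: "cut A = card A" "5 \<le> card A" using blk[OF A] by auto
  \<comment> \<open>The arcs between different blocks. Each vertex has exactly one, so they form a
    perfect matching of the whole graph.\<close>
  define Out where "Out = {(u, v) \<in> E. \<forall>B. cut_atom s B \<longrightarrow> u \<in> B \<longrightarrow> v \<notin> B}"
  have OE: "Out \<subseteq> E" by (auto simp: Out_def)
  have finO: "finite Out" using OE finite_E finite_subset by blast
  have symO: "sym Out" using symR by (auto simp: Out_def sym_def)
  have irrO: "irrefl Out" using OE irrefl by (auto simp: irrefl_def)
  have deg: "card (Out `` {v}) = 1" if v: "v \<in> V" for v
  proof -
    obtain B where B: "cut_atom s B" "v \<in> B" using ex[OF v] by blast
    then have "Out `` {v} = E `` {v} - (E `` {v} \<inter> B)" using uniq by (auto simp: Out_def)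
    moreover have "finite (E `` {v})" using Image_sub finite_sub by blast
    ultimately have "card (Out `` {v}) = k - card (E `` {v} \<inter> B)"
      using regular[OF v] by (simp add: card_Diff_subset_Int)
    then show ?thesis using conjunct1[OF blk[OF B]] by linarith
  qed
  have outer: "1 \<le> arcs_between Out C' X" if C': "C' \<in> F" for C'
  proof -
    have C'V: "C' \<subseteq> V" "finite C'" using F_sub[OF C'] finite_sub by auto
    have "arcs_between Out C' V = (\<Sum>v\<in>C'. card (Out `` {v} \<inter> V))"
      by (rule arcs_between_eq_sum[OF C'V(2) finO])
    also have "\<dots> = (\<Sum>v\<in>C'. 1)"
    proof (rule sum.cong[OF refl])
      fix v assume "v \<in> C'"
      moreover have "Out `` {v} \<inter> V = Out `` {v}" using OE R_sub by blast
      ultimately show "card (Out `` {v} \<inter> V) = 1" using deg C'V by auto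
    qed
    finally have "arcs_between Out C' V = card C'" by simp
    moreover have "V = C' \<union> (V - C')" using C'V by blast
    then have "arcs_between Out C' V = arcs_between Out C' C' + arcs_between Out C' (V - C')"
      using arcs_between_Un_right[OF finO, of C' "V - C'" C'] by simp
    ultimately have "odd (arcs_between Out C' (V - C'))"
      using F_odd[OF C'] even_arcs_within[OF C'V(2) finO symO irrO] by (metis even_add)
    moreover have "Out \<inter> C' \<times> (V - C') = Out \<inter> C' \<times> X"
      using F_Image[OF C'] F_sub[OF C'] X_sub OE by blast
    ultimately have "odd (arcs_between Out C' X)" by (simp add: arcs_between_def)
    then show ?thesis by (metis One_nat_def Suc_leI even_zero gr0I)
  qed
  have "\<exists>B. cut_atom s B \<and> B \<inter> C \<noteq> {} \<and> \<not> B \<subseteq> C"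
  proof (rule ccontr)
    assume "\<not> ?thesis"
    then have un: "\<And>B. cut_atom s B \<Longrightarrow> B \<inter> C \<noteq> {} \<Longrightarrow> B \<subseteq> C" by blast
    \<comment> \<open>All arcs from \<open>C\<close> to \<open>X\<close> would be outer, at least
      \<open>card A \<ge> 5\<close> of them. With one from every other member, \<open>X\<close>
      would receive at least \<open>card F + 4\<close>.\<close>
    have "E \<inter> C \<times> X \<subseteq> Out \<inter> C \<times> X" using un F_sub[OF C(1)] by (auto simp: Out_def)
    then have "ab C X \<le> arcs_between Out C X"
      unfolding arcs_between_def using finO by (intro card_mono) auto
    then have 5: "5 \<le> arcs_between Out C X"
      using F_cut[OF C(1)] cut_atom_le[OF A sC] m by simp
    have "(\<Sum>C'\<in>F - {C}. 1) \<le> (\<Sum>C'\<in>F - {C}. arcs_between Out C' X)"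
      using outer by (intro sum_mono) auto
    moreover have "(\<Sum>C'\<in>F. arcs_between Out C' X) = arcs_between Out C X + (\<Sum>C'\<in>F - {C}. arcs_between Out C' X)"
      using C(1) finite_F by (intro sum.remove)
    moreover have "(\<Sum>C'\<in>F. arcs_between Out C' X) \<le> card X"
      using sum_arcs_to_X[OF symO OE deg] by simp
    moreover have "(\<Sum>C'\<in>F - {C}. 1) = card F - 1" using C(1) finite_F by simp
    moreover have "card F > 0" using C(1) finite_F by (auto simp: card_gt_0_iff)
    ultimately show False using 5 F_ge by linarith
  qed
  then obtain B where B: "cut_atom s B" "B \<inter> C \<noteq> {}" "\<not> B \<subseteq> C" by blast
  note BV = sub(1)[OF B(1)]
  have Bc: "cut B = cut A" "card B = card A" by (rule eqA[OF B(1)])+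
  have regB: "\<And>v. v \<in> B \<Longrightarrow> card (E `` {v} \<inter> B) + 1 = k" using blk[OF B(1)] by blast
  have "card B < c" using Bc m Ac by simp
  note partB = part[OF BV regB this]
  have fin: "finite B" "finite C" "finite (V - B)" "finite (V - C)"
    using BV CV finite_sub finite_V by auto
  have cB: "card B = card (C \<inter> B) + card (B - C)"
    using fin by (metis Int_commute card_Int_Diff)
  have cC: "card C = card (C \<inter> B) + card (C - B)"
    using fin by (metis card_Int_Diff)
  have "V - C = (V - (C \<union> B)) \<union> (B - C)" using BV by blast
  then have cVC: "card (V - C) = card (V - (C \<union> B)) + card (B - C)"
    using fin finite_V by (subst card_Un_disjoint[symmetric]) auto
  have "V - B = (V - (C \<union> B)) \<union> (C - B)" using CV by blast
  then have cVB: "card (V - B) = card (V - (C \<union> B)) + card (C - B)"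
    using fin finite_V by (subst card_Un_disjoint[symmetric]) auto
  have "card B \<le> card (V - B)"
    using cut_atom_half[OF B(1)] BV fin by (simp add: card_Diff_subset)
  with large[OF B(1)] have VB: "2 * s \<le> card (V - B) + 1" by simp
  show False
  proof (cases "s \<le> card (C \<inter> B) \<and> s \<le> card (V - (C \<union> B))")
    case True
    have "splits s (C \<union> B)"
      using True cC C(2) CV BV card_mono[of "C \<union> B" C] fin by (auto simp: splits_def)
    then have "cut B \<le> cut (C \<union> B)" by (rule cut_atom_le[OF B(1)])
    then have "cut (C \<inter> B) \<le> cut C" using cut_submodular[OF CV BV] by simp
    moreover have "c \<le> cut (C \<inter> B)" using True B by (intro partB) auto
    ultimately show ?thesis using lt by simp
  next
    case not1: False
    show ?thesis
    proof (cases "s \<le> card (B - C) \<and> s \<le> card (C - B)")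
      case True
      have "V - C \<subseteq> V - (C - B)" by blast
      then have "card (V - C) \<le> card (V - (C - B))" using finite_V by (intro card_mono) auto
      then have "splits s (C - B)"
        using True CV sC by (auto simp: splits_def)
      then have "cut B \<le> cut (C - B)" by (rule cut_atom_le[OF B(1)])
      then have "cut (B - C) \<le> cut C" using cut_posimodular[OF CV BV] by simp
      moreover have "c \<le> cut (B - C)" using True B by (intro partB) auto
      ultimately show ?thesis using lt by simp
    next
      case not2: False
      have "s \<le> card (V - C)" using sC by (simp add: splits_def)
      \<comment> \<open>Neither uncrossing applies, so two of the four parts are below
        \<open>s\<close>, and their union is \<open>B\<close>, \<open>C\<close> or the complement of
        one of these. \<open>B\<close> and \<open>V - B\<close> are too large for that;
        \<open>C\<close> and \<open>V - C\<close> fall under \<open>small\<close>.\<close>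
      then have "card C + 2 \<le> 2 * s \<or> card (V - C) + 2 \<le> 2 * s"
        using not1 not2 cB cC cVC cVB VB large[OF B(1)] by linarith
      then have "c \<le> cut C"
        using small[OF CV C(2)] small[of "V - C"] \<open>s \<le> card (V - C)\<close> cut_compl[OF CV] by auto
      then show ?thesis using lt by simp
    qed
  qed
qed

text \<open>All requirements for \<open>s = 2\<close> follow from concavity:
  \<open>m * (k + 1 - m)\<close> is at least \<open>2 * k - 2\<close> for
  \<open>2 \<le> m \<le> k - 1\<close>, used for \<open>m\<close> the size of a part and for
  \<open>m = r + 1\<close>, and \<open>l * (k - l)\<close> is at least \<open>k - 1\<close> for
  \<open>1 \<le> l < k\<close>, used for what a large part leaves of its block.\<close>

lemma nontrivial_cut:
  assumes k: "5 \<le> k" and C: "C \<in> F" "2 \<le> card C"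
  shows "2 * k - 2 \<le> cut C"
proof (rule barrier_large_cut[where s = 2])
  fix S assume S: "S \<subseteq> V" "2 \<le> card S" "card S + 2 \<le> 2 * 2"
  then have "card S = 2" by simp
  then show "2 * k - 2 \<le> cut S" using cut_ge[OF S(1)] by simp
next
  fix n r assume n: "2 * 2 \<le> n + 1" "r < n" "r < k" "n * (k - r) < 2 * k - 2"
  have "r + 1 = k"
  proof (rule ccontr)
    assume "r + 1 \<noteq> k"
    then obtain j where j: "k = r + 2 + j" using n(3) by (metis Suc_eq_plus1 Suc_leI add_2_eq_Suc' le_Suc_ex le_neq_implies_less add_Suc_right)
    show False
    proof (cases r)
      case 0
      have "3 * k \<le> n * k" using n(1) by (intro mult_right_mono) auto
      then show ?thesis using n(4) unfolding 0 diff_zero by linarith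
    next
      case (Suc i)
      have "(r + 1) * (k - r) \<le> n * (k - r)" using n(2) by (intro mult_right_mono) auto
      moreover have "(r + 1) * (k - r) = 2 * k - 2 + i * j" using Suc j by (simp add: algebra_simps)
      ultimately show ?thesis using n(4) by simp
    qed
  qed
  then show "r + 1 = k \<and> 5 \<le> n" using n(2) k by simp
next
  fix B K assume B: "B \<subseteq> V" "\<And>v. v \<in> B \<Longrightarrow> card (E `` {v} \<inter> B) + 1 = k" "card B < 2 * k - 2"
    and K: "K \<subset> B" "2 \<le> card K"
  have KB: "K \<subseteq> B" and KV: "K \<subseteq> V" using K B by auto
  have finB: "finite B" using B finite_sub by auto
  have c: "card (B - K) = card B - card K" "card K < card B"
    using KB K(1) finB by (auto simp: card_Diff_subset finite_subset psubset_card_mono)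
  show "2 * k - 2 \<le> cut K"
  proof (cases "card K \<le> k - 1")
    case True
    have "0 \<le> (int (card K) - 2) * (int k - 1 - int (card K))"
      using K(2) True k by (intro mult_nonneg_nonneg) auto
    then have "2 * int k - 2 \<le> int (card K) * (int k + 1 - int (card K))" by (simp add: algebra_simps)
    then show ?thesis using cut_ge[OF KV] by linarith
  next
    case False
    define l where "l = card (B - K)"
    have l: "1 \<le> l" "l + 3 \<le> k" using False c B(3) by (auto simp: l_def)
    have "0 \<le> (int l - 1) * (int k - 1 - int l)" using l by (intro mult_nonneg_nonneg) auto
    then have "int k - 1 \<le> int l * (int k - int l)" by (simp add: algebra_simps)
    then show ?thesis
      using block_subset_cut[OF B(1,2) KB] False unfolding l_def[symmetric] by linarith
  qed
qed (use C in auto)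

text \<open>Mantel's bound settles sets of 3 to 6 vertices. With \<open>s = 4\<close>, the largest
  value that the complement of a member guarantees, an atom in question has at least 7 vertices, so
  two arcs leaving the block at each vertex would already give a cut of 14, more than
  \<open>2 * k\<close>.\<close>

lemma triangle_free_nontrivial_cut:
  assumes k: "k = 5 \<or> k = 6" and C: "C \<in> F" "2 \<le> card C"
    and tf: "triangle_free E"
  shows "2 * k \<le> cut C"
proof (cases "card C = 3")
  case True
  have "C \<subseteq> V" using F_sub C by blast
  then show ?thesis using triangle_free_cut[OF tf, of C] True k by (auto simp: power2_eq_square)
next
  case False
  then have "4 \<le> card C" using C F_odd[OF C(1)] by (cases "card C = 2") auto
  have mid: "2 * k \<le> cut S" if S: "S \<subseteq> V" "4 \<le> card S" "card S \<le> 6" for S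
  proof -
    have "card S = 4 \<or> card S = 5 \<or> card S = 6" using S by linarith
    then show ?thesis using triangle_free_cut[OF tf S(1)] k by (auto simp: power2_eq_square)
  qed
  show ?thesis
  proof (rule barrier_large_cut[where s = 4])
    fix S assume "S \<subseteq> V" "4 \<le> card S" "card S + 2 \<le> 2 * 4"
    then show "2 * k \<le> cut S" by (intro mid) auto
  next
    fix n r assume n: "2 * 4 \<le> n + 1" "r < n" "r < k" "n * (k - r) < 2 * k"
    have "r + 1 = k"
    proof (rule ccontr)
      assume "r + 1 \<noteq> k"
      then have "2 \<le> k - r" using n(3) by simp
      then have "7 * 2 \<le> n * (k - r)" using n(1) by (intro mult_mono) auto
      then show False using n(4) k by auto
    qed
    then show "r + 1 = k \<and> 5 \<le> n" using n(1) by simp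
  next
    fix B K assume B: "B \<subseteq> V" "\<And>v. v \<in> B \<Longrightarrow> card (E `` {v} \<inter> B) + 1 = k" "card B < 2 * k"
      and K: "K \<subset> B" "4 \<le> card K"
    have KB: "K \<subseteq> B" and KV: "K \<subseteq> V" using K B by auto
    have finB: "finite B" using B finite_sub by auto
    have c: "card (B - K) = card B - card K" "card K < card B"
      using KB K(1) finB by (auto simp: card_Diff_subset finite_subset psubset_card_mono)
    show "2 * k \<le> cut K"
    proof (cases "card K \<le> 6")
      case True
      then show ?thesis using mid[OF KV] K(2) by simp
    next
      case False
      define l where "l = card (B - K)"
      have l: "1 \<le> l" "l + 8 \<le> 2 * k" using False c B(3) by (auto simp: l_def)
      have "0 \<le> (int l - 1) * (int k - 1 - int l)" using l k by (intro mult_nonneg_nonneg) auto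
      then have "int k - 1 \<le> int l * (int k - int l)" by (simp add: algebra_simps)
      then show ?thesis
        using block_subset_cut[OF B(1,2) KB] False k unfolding l_def[symmetric] by linarith
    qed
  qed (use C \<open>4 \<le> card C\<close> in auto)
qed

end

section \<open>Expansion constants, triangles and connected sets\<close>

context transitive_graph
begin

text \<open>For \<open>d \<ge> 1\<close> and \<open>5 \<le> (d + 1) * a\<close>, an excess
  \<open>d * a\<close> below 4 leaves only \<open>a = 3\<close>, \<open>d = 1\<close>, excluded by
  the parity of \<open>a\<close>. For \<open>k \<ge> 6\<close> an excess of 4 leaves
  \<open>a = d = 2\<close> or \<open>a = 4\<close>, \<open>d = 1\<close>, and the even number
  \<open>a\<close> divides \<open>card S\<close>. For \<open>k = 5\<close> the pair
  \<open>a = 1\<close>, \<open>d = 4\<close> defeats this parity argument.\<close>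

lemma neighbourhood_expansion:
  assumes k: "5 \<le> k"
    and nonbip: "\<nexists>U W. V = U \<union> W \<and> U \<inter> W = {} \<and> E \<subseteq> U \<times> W \<union> W \<times> U"
    and ev: "even (card V)"
    and S: "S \<subseteq> V" "S \<noteq> {}" "E `` S \<noteq> V"
  shows "card S + 4 \<le> card (E `` S)"
    and "6 \<le> k \<Longrightarrow> card (E `` S) = card S + 4 \<Longrightarrow> even (card S)"
proof -
  have "k > 0" using k by simp
  obtain a d where ad: "a > 0" "k \<le> Suc d * a"
    and ge: "\<forall>S \<subseteq> V. S \<noteq> {} \<and> E `` S \<noteq> V \<longrightarrow> d * a + card S \<le> card (E `` S)"
    and dv: "\<forall>S \<subseteq> V. S \<noteq> {} \<and> E `` S \<noteq> V \<and> card (E `` S) = d * a + card S \<longrightarrow> a dvd card S"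
    and d0: "d = 0 \<longrightarrow> (\<exists>U W. V = U \<union> W \<and> U \<inter> W = {} \<and> E \<subseteq> U \<times> W \<union> W \<times> U)"
    and "d = 1 \<longrightarrow> (\<exists>v \<in> V. (v, v) \<notin> E)"
    and d1: "d = 1 \<and> even (card V) \<longrightarrow> even a"
    by (rule atom_parameters[OF regular \<open>k > 0\<close> S])
  have geS: "d * a + card S \<le> card (E `` S)"
    by (rule ge[rule_format, OF S(1) conjI[OF S(2,3)]])
  have "d \<noteq> 0" using d0 nonbip by blast
  have le: "a \<le> d * a" "d \<le> d * a" using ad(1) \<open>d \<noteq> 0\<close> by simp_all
  have four: "4 \<le> d * a"
  proof (rule ccontr)
    assume "\<not> 4 \<le> d * a"
    then have lt: "d * a < 4" by simp
    then have "a \<le> 3" "d \<le> 3" using le by linarith+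
    then have "a \<in> {1, 2, 3}" "d \<in> {1, 2, 3}" using ad(1) \<open>d \<noteq> 0\<close> by auto
    then show False using ad(2) k d1 ev lt by auto
  qed
  then show "card S + 4 \<le> card (E `` S)" using geS by simp
  assume k6: "6 \<le> k" and eq: "card (E `` S) = card S + 4"
  then have da: "d * a = 4" using four geS by simp
  then have "a \<le> 4" "d \<le> 4" using le by linarith+
  then have "a \<in> {1, 2, 3, 4}" "d \<in> {1, 2, 3, 4}" using ad(1) \<open>d \<noteq> 0\<close> by auto
  then have "even a" using ad(2) k6 d1 ev da by auto
  moreover have "a dvd card S" 
    using dv[rule_format, OF S(1) conjI[OF S(2) conjI[OF S(3)]]] eq da by simp
  ultimately show "even (card S)" by (rule dvd_trans)
qed

lemma with_loops: "transitive_relation V (E \<union> Id_on V)"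
proof
  show "finite V" by (rule finite_V)
  show "E \<union> Id_on V \<subseteq> V \<times> V" using R_sub by auto
  show "sym (E \<union> Id_on V)" using R_sym by (auto simp: sym_def)
  fix x y assume "x \<in> V" "y \<in> V"
  then obtain f where f: "rel_automorphism V E f" "f x = y" using transitive by blast
  then have "rel_automorphism V (E \<union> Id_on V) f"
    unfolding rel_automorphism_def bij_betw_def inj_on_def by auto
  then show "\<exists>f. rel_automorphism V (E \<union> Id_on V) f \<and> f x = y" using f(2) by blast
next
  fix S assume "S \<subseteq> V" "S \<noteq> {}" "(E \<union> Id_on V) `` S \<subseteq> S"
  then show "S = V" by (intro connected) auto
qed

text \<open>Loops rule out \<open>d = 0\<close> and \<open>d = 1\<close>, and the image of a vertex
  has \<open>k + 1\<close> elements. For \<open>k = 5\<close>, \<open>6 \<le> (d + 1) * a\<close>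
  forces \<open>d * a \<ge> 4\<close>, with equality only for \<open>a = d = 2\<close>; for
  \<open>k = 6\<close>, \<open>7 \<le> (d + 1) * a\<close> forces
  \<open>d * a \<ge> 6\<close>.\<close>

lemma closed_neighbourhood_expansion:
  assumes k: "k = 5 \<or> k = 6" and S: "S \<subseteq> V" "S \<noteq> {}" "S \<union> E `` S \<noteq> V"
  shows "k = 5 \<Longrightarrow> card S + 4 \<le> card (S \<union> E `` S)"
    and "k = 5 \<Longrightarrow> card (S \<union> E `` S) = card S + 4 \<Longrightarrow> even (card S)"
    and "k = 6 \<Longrightarrow> card S + 6 \<le> card (S \<union> E `` S)"
proof -
  interpret L: transitive_relation V "E \<union> Id_on V" by (rule with_loops)
  have im: "(E \<union> Id_on V) `` S = S \<union> E `` S" if "S \<subseteq> V" for S using that by auto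
  have S': "(E \<union> Id_on V) `` S \<noteq> V" using im[OF S(1)] S(3) by simp
  have deg: "card ((E \<union> Id_on V) `` {v}) = Suc k" if v: "v \<in> V" for v
  proof -
    have "v \<notin> E `` {v}" using irrefl by (auto simp: irrefl_def)
    moreover have "finite (E `` {v})" using Image_sub finite_sub by blast
    ultimately show ?thesis using im[of "{v}"] v regular[OF v] by simp
  qed
  obtain v where v: "v \<in> V" using S by blast
  obtain a d where ad: "a > 0" "Suc k \<le> Suc d * a"
    and ge: "\<forall>S \<subseteq> V. S \<noteq> {} \<and> (E \<union> Id_on V) `` S \<noteq> V \<longrightarrow> d * a + card S \<le> card ((E \<union> Id_on V) `` S)"
    and dv: "\<forall>S \<subseteq> V. S \<noteq> {} \<and> (E \<union> Id_on V) `` S \<noteq> V \<and>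
      card ((E \<union> Id_on V) `` S) = d * a + card S \<longrightarrow> a dvd card S"
    and d0: "d = 0 \<longrightarrow> (\<exists>U W. V = U \<union> W \<and> U \<inter> W = {} \<and> E \<union> Id_on V \<subseteq> U \<times> W \<union> W \<times> U)"
    and d1: "d = 1 \<longrightarrow> (\<exists>v \<in> V. (v, v) \<notin> E \<union> Id_on V)"
    and "d = 1 \<and> even (card V) \<longrightarrow> even a"
    by (rule L.atom_parameters[OF deg zero_less_Suc S(1,2) S'], assumption) (rule that; assumption)
  have geS: "d * a + card S \<le> card (S \<union> E `` S)"
    using ge[rule_format, OF S(1) conjI[OF S(2) S']] im[OF S(1)] by simp
  have dvS: "card (S \<union> E `` S) = d * a + card S \<Longrightarrow> a dvd card S"
    using dv[rule_format, OF S(1) conjI[OF S(2) conjI[OF S']]] im[OF S(1)] by simp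
  have "d \<noteq> 0"
  proof
    assume "d = 0"
    then obtain U W where "U \<inter> W = {}" "E \<union> Id_on V \<subseteq> U \<times> W \<union> W \<times> U" using d0 by blast
    then show False using v by blast
  qed
  moreover have "d \<noteq> 1" using d1 by auto
  ultimately have d2: "2 \<le> d" by simp
  have le: "2 * a \<le> d * a" "d \<le> d * a" using ad(1) d2 by simp_all
  show "card S + 4 \<le> card (S \<union> E `` S)" if k5: "k = 5"
  proof -
    have "4 \<le> d * a"
    proof (rule ccontr)
      assume "\<not> 4 \<le> d * a"
      then have lt: "d * a < 4" by simp
      then have "a \<le> 1" "d \<le> 3" using le by linarith+
      then have "a = 1" "d \<in> {2, 3}" using ad(1) d2 by auto
      then show False using ad(2) k5 by auto
    qed
    then show ?thesis using geS by simp
  qed note four = this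
  show "even (card S)" if k5: "k = 5" and eq: "card (S \<union> E `` S) = card S + 4"
  proof -
    have "d * a \<le> 4" using geS eq by simp
    then have "a \<le> 2" "d \<le> 4" using le by linarith+
    then have "a \<in> {1, 2}" "d \<in> {2, 3, 4}" using ad(1) d2 by auto
    then have "a = 2" "d * a = 4" using ad(2) k5 \<open>d * a \<le> 4\<close> by auto
    then show ?thesis using dvS eq by simp
  qed
  show "card S + 6 \<le> card (S \<union> E `` S)" if k6: "k = 6"
  proof -
    have "6 \<le> d * a"
    proof (rule ccontr)
      assume "\<not> 6 \<le> d * a"
      then have lt: "d * a < 6" by simp
      then have "a \<le> 2" "d \<le> 5" using le by linarith+
      then have "a \<in> {1, 2}" "d \<in> {2, 3, 4, 5}" using ad(1) d2 by auto
      then show False using ad(2) k6 lt by auto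
    qed
    then show ?thesis using geS by simp
  qed
qed

text \<open>This constant is twice the number of triangles through a vertex.\<close>

lemma neighbourhood_arcs_const:
  assumes "u \<in> V" "v \<in> V"
  shows "ab (E `` {u}) (E `` {u}) = ab (E `` {v}) (E `` {v})"
proof -
  obtain f where f: "rel_automorphism V E f" "f u = v" using transitive assms by blast
  have "E `` {v} = f ` (E `` {u})" using automorphism_Image[OF f(1), of "{u}"] f(2) assms by simp
  then show ?thesis using automorphism_ab[OF f(1)] Image_sub by simp
qed

lemma triangle_freeI:
  assumes v: "v \<in> V" and z: "ab (E `` {v}) (E `` {v}) = 0"
  shows "triangle_free E"
  unfolding triangle_free_def
proof (intro allI impI notI)
  fix x y w assume xyw: "(x, y) \<in> E" "(y, w) \<in> E" "(x, w) \<in> E"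
  then have "x \<in> V" using R_sub by blast
  then have "E \<inter> E `` {x} \<times> E `` {x} = {}"
    using neighbourhood_arcs_const[OF _ v] z finite_E by (simp add: arcs_between_def)
  then show False using xyw by blast
qed

text \<open>Connectedness of the subgraph induced on \<open>D\<close>, in the closed-set form used
  for \<open>V\<close> itself.\<close>

definition linked :: "'a set \<Rightarrow> bool" where
  "linked D \<longleftrightarrow> D \<subseteq> V \<and> D \<noteq> {} \<and> (\<forall>T \<subseteq> D. T \<noteq> {} \<longrightarrow> E `` T \<inter> D \<subseteq> T \<longrightarrow> T = D)"

lemma linked_insert:
  assumes D: "linked D" and x: "x \<in> E `` D"
  shows "linked (insert x D)"
  unfolding linked_def
proof (intro conjI allI impI)
  show "insert x D \<subseteq> V" using D x R_sub by (auto simp: linked_def)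
  show "insert x D \<noteq> {}" by simp
  fix T assume T: "T \<subseteq> insert x D" "T \<noteq> {}" "E `` T \<inter> insert x D \<subseteq> T"
  obtain y where y: "y \<in> D" "(y, x) \<in> E" using x by blast
  have "T \<inter> D \<noteq> {}"
  proof
    assume "T \<inter> D = {}"
    then have "T = {x}" using T by blast
    then have "y \<in> T" using T(3) y symR by blast
    then show False using \<open>T \<inter> D = {}\<close> y by blast
  qed
  moreover have "E `` (T \<inter> D) \<inter> D \<subseteq> T \<inter> D" using T(3) by blast
  ultimately have "T \<inter> D = D" using D by (simp add: linked_def)
  then have "y \<in> T" using y by blast
  then have "x \<in> T" using T(3) y by blast
  then show "T = insert x D" using T(1) \<open>T \<inter> D = D\<close> by blast
qed

lemma linked_image:
  assumes f: "rel_automorphism V E f" and D: "linked D"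
  shows "linked (f ` D)"
  unfolding linked_def
proof (intro conjI allI impI)
  have DV: "D \<subseteq> V" using D by (simp add: linked_def)
  show "f ` D \<subseteq> V" by (rule automorphism_range[OF f DV])
  show "f ` D \<noteq> {}" using D by (simp add: linked_def)
  fix T assume T: "T \<subseteq> f ` D" "T \<noteq> {}" "E `` T \<inter> f ` D \<subseteq> T"
  define S where "S = {x \<in> D. f x \<in> T}"
  have fS: "f ` S = T" using T(1) by (auto simp: S_def)
  have "E `` S \<inter> D \<subseteq> S"
  proof
    fix y assume "y \<in> E `` S \<inter> D"
    then obtain x where x: "x \<in> D" "f x \<in> T" "(x, y) \<in> E" and y: "y \<in> D" by (auto simp: S_def)
    then have "(f x, f y) \<in> E" using f DV by (auto simp: rel_automorphism_def)
    then have "f y \<in> T" using T(3) x y by blast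
    then show "y \<in> S" using y by (simp add: S_def)
  qed
  moreover have "S \<noteq> {}" using fS T(2) by blast
  moreover have "S \<subseteq> D" by (auto simp: S_def)
  ultimately have "S = D" using D by (simp add: linked_def)
  then show "T = f ` D" using fS by simp
qed

text \<open>
  A largest connected set \<open>D\<close> avoiding a neighbourhood: it would grow inside \<open>V - E `` {w}\<close>
  for any other \<open>w\<close> whose neighbourhood it avoids.
\<close>

lemma largest_avoiding:
  assumes v: "v \<in> V"
  obtains D where "linked D" "D \<inter> E `` {v} = {}"
    "\<And>w. w \<in> V \<Longrightarrow> D \<inter> E `` {w} = {} \<Longrightarrow> E `` D - D \<subseteq> E `` {w}"
proof -
  \<comment> \<open>The maximum is taken over all vertices \<open>u\<close>: an automorphism can
    then move the maximiser to the given \<open>v\<close>, and every \<open>w\<close> competes with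
    it.\<close>
  let ?P = "\<lambda>n. \<exists>u D. u \<in> V \<and> linked D \<and> D \<inter> E `` {u} = {} \<and> card D = n"
  have "linked {v}" using v by (auto simp: linked_def)
  moreover have "{v} \<inter> E `` {v} = {}" using irrefl by (auto simp: irrefl_def)
  ultimately have "?P 1" using v by (intro exI[of _ v] exI[of _ "{v}"]) auto
  moreover have "\<forall>n. ?P n \<longrightarrow> n \<le> card V"
    using finite_V by (auto simp: linked_def card_mono)
  ultimately obtain n where n: "?P n" "\<And>n'. ?P n' \<Longrightarrow> n' \<le> n"
    using Nat.ex_has_greatest_nat[of ?P 1 "card V"] by blast
  then obtain u D0 where u: "u \<in> V" "linked D0" "D0 \<inter> E `` {u} = {}" "card D0 = n" by blast
  obtain f where f: "rel_automorphism V E f" "f u = v" using transitive u(1) v by blast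
  have D0V: "D0 \<subseteq> V" using u(2) by (simp add: linked_def)
  define D where "D = f ` D0"
  have D: "linked D" "card D = n"
    using linked_image[OF f(1) u(2)] automorphism_card[OF f(1) D0V] u(4) by (simp_all add: D_def)
  have "E `` {v} = f ` (E `` {u})" using automorphism_Image[OF f(1), of "{u}"] f(2) u(1) by simp
  moreover have "f ` D0 \<inter> f ` (E `` {u}) = f ` (D0 \<inter> E `` {u})"
    using f(1) D0V Image_sub[of "{u}"]
    by (metis bij_betw_def inj_on_image_Int rel_automorphism_def)
  ultimately have Dv: "D \<inter> E `` {v} = {}" using u(3) by (simp add: D_def)
  have "E `` D - D \<subseteq> E `` {w}" if w: "w \<in> V" "D \<inter> E `` {w} = {}" for w
  proof
    fix x assume x: "x \<in> E `` D - D"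
    show "x \<in> E `` {w}"
    proof (rule ccontr)
      assume nx: "x \<notin> E `` {w}"
      have "linked (insert x D)" using linked_insert[OF D(1)] x by blast
      moreover have "insert x D \<inter> E `` {w} = {}" using w(2) nx by blast
      moreover have "card (insert x D) = Suc n"
        using x D finite_sub by (auto simp: linked_def)
      ultimately have "?P (Suc n)" using w(1) by blast
      then show False using n(2)[of "Suc n"] by simp
    qed
  qed
  then show ?thesis using that D(1) Dv by blast
qed

end

section \<open>The contradiction for degree at least five\<close>

context graph_barrier
begin

text \<open>A connected set \<open>D\<close> avoiding \<open>X\<close> lies inside a member or
  misses it, so it misses one of the two, \<open>C\<close>. It then avoids the neighbourhood of
  every vertex of \<open>C\<close>, and by maximality its boundary lies in all of them:
  \<open>C\<close> is completely joined to at least 4 vertices outside.\<close>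

lemma neighbourhood_barrier_large_cut:
  assumes k: "k = 5" and v: "v \<in> V" "X = E `` {v}"
    and C: "C1 \<in> F" "C2 \<in> F" "C1 \<noteq> C2" "3 \<le> card C1" "3 \<le> card C2"
  shows "12 \<le> cut C1 \<or> 12 \<le> cut C2"
proof -
  obtain D where D: "linked D" "D \<inter> E `` {v} = {}"
    and grow: "\<And>w. w \<in> V \<Longrightarrow> D \<inter> E `` {w} = {} \<Longrightarrow> E `` D - D \<subseteq> E `` {w}"
    by (rule largest_avoiding[OF v(1)]) blast
  have DV: "D \<subseteq> V" "D \<noteq> {}" using D by (auto simp: linked_def)
  have inside: "D \<subseteq> C \<or> D \<inter> C = {}" if CF: "C \<in> F" for C
  proof (cases "D \<inter> C = {}")
    case False
    have "E `` (D \<inter> C) \<inter> D \<subseteq> D \<inter> C" using F_Image[OF CF] D(2) v(2) by blast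
    then have "D \<inter> C = D" using D(1) False unfolding linked_def by blast
    then show ?thesis by blast
  qed simp
  have "C1 \<inter> C2 = {}" using F_disjoint C by (auto simp: disjoint_def)
  then have "D \<inter> C1 = {} \<or> D \<inter> C2 = {}" using inside[OF C(1)] DV by blast
  then obtain C where CF: "C \<in> F" "3 \<le> card C" "D \<inter> C = {}" and C12: "C = C1 \<or> C = C2"
    using C by blast
  have CV: "C \<subseteq> V" using F_sub CF(1) by blast
  have dis: "D \<inter> E `` C = {}" using F_Image[OF CF(1)] CF(3) D(2) v(2) by blast
  define Y where "Y = E `` D - D"
  have DC: "C \<inter> (D \<union> E `` D) = {}" using dis CF(3) symR by blast
  then have "D \<union> E `` D \<noteq> V" using CV F_nonempty[OF CF(1)] by blast
  then have "card D + 4 \<le> card (D \<union> E `` D)"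
    using closed_neighbourhood_expansion(1)[OF _ DV] k by simp
  moreover have "D \<union> E `` D = D \<union> Y" by (auto simp: Y_def)
  moreover have "card (D \<union> Y) = card D + card Y"
    using DV Image_sub[of D] finite_sub by (intro card_Un_disjoint) (auto simp: Y_def)
  ultimately have "4 \<le> card Y" by simp
  have "C \<times> Y \<subseteq> E \<inter> C \<times> (V - C)"
  proof
    fix z assume "z \<in> C \<times> Y"
    then obtain w y where wy: "z = (w, y)" "w \<in> C" "y \<in> Y" by blast
    then have "w \<in> V" "D \<inter> E `` {w} = {}" using CV dis by auto
    then have "y \<in> E `` {w}" using grow wy(3) by (auto simp: Y_def)
    moreover have "y \<notin> C" using wy(3) DC by (auto simp: Y_def)
    ultimately show "z \<in> E \<inter> C \<times> (V - C)" using wy R_sub by auto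
  qed
  then have "card (C \<times> Y) \<le> cut C"
    unfolding cut_def arcs_between_def using finite_E by (intro card_mono) auto
  moreover have "3 * 4 \<le> card C * card Y" using CF(2) \<open>4 \<le> card Y\<close> by (intro mult_mono) auto
  ultimately have "12 \<le> cut C" by (simp add: card_cartesian_product)
  then show ?thesis using C12 by blast
qed

theorem no_barrier:
  assumes k: "5 \<le> k"
    and nonbip: "\<nexists>U W. V = U \<union> W \<and> U \<inter> W = {} \<and> E \<subseteq> U \<times> W \<union> W \<times> U"
    and ev: "even (card V)"
  shows False
proof -
  define I where "I = {C \<in> F. card C = 1}"
  define N where "N = {C \<in> F. card C \<noteq> 1}"
  define p where "p = card N"
  have FIN: "F = I \<union> N" "I \<inter> N = {}" by (auto simp: I_def N_def)
  have fin: "finite I" "finite N" using finite_F by (auto simp: I_def N_def)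
  have cF: "card F = card I + p" unfolding FIN(1) p_def using FIN(2) fin by (rule card_Un_disjoint[rotated 2])
  have N3: "3 \<le> card C" if "C \<in> N" for C
  proof -
    have "odd (card C)" "card C \<noteq> 1" using that F_odd by (auto simp: N_def)
    then show ?thesis by (cases "card C = 2") (auto elim: oddE)
  qed
  have NF: "C \<in> F" if "C \<in> N" for C using that by (simp add: N_def)
  have Icut: "k \<le> cut C" if "C \<in> F" for C
    using edge_connectivity F_sub[OF that] F_nonempty[OF that] F_ne_V[OF that] by blast
  define I0 where "I0 = \<Union> I"
  have I0V: "I0 \<subseteq> V" using F_sub by (auto simp: I0_def I_def)
  have I0X: "E `` I0 \<subseteq> X"
  proof
    fix y assume "y \<in> E `` I0"
    then obtain C x where C: "C \<in> F" "card C = 1" "x \<in> C" "(x, y) \<in> E" by (auto simp: I0_def I_def)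
    then have "C = {x}" by (metis card_1_singletonE singletonD)
    then have "y \<noteq> x" "y \<in> C \<union> X" using C irrefl F_Image[OF C(1)] by (auto simp: irrefl_def)
    then show "y \<in> X" using \<open>C = {x}\<close> by simp
  qed
  have cI0: "card I0 = card I"
  proof -
    have "card I0 = (\<Sum>C\<in>I. card C)"
      unfolding I0_def using F_disjoint F_sub finite_sub
      by (intro card_Union_disjoint) (auto simp: I_def disjoint_def pairwise_def disjnt_def intro!: card_ge_0_finite)
    then show ?thesis by (simp add: I_def)
  qed
  have "F \<noteq> {}" using X_ge F_ge by auto
  then obtain C0 where "C0 \<in> F" by blast
  then have XV: "X \<noteq> V" using F_sub[of C0] F_nonempty[of C0] by blast
  have finX: "finite X" using X_sub finite_sub by blast
  have cXI: "card X \<le> card I0 + p + 2" using F_ge cF cI0 by simp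
  \<comment> \<open>Each singleton takes \<open>k\<close> of the arcs at \<open>X\<close>, so what
    remains for the other members depends on \<open>p\<close> alone.\<close>
  have bound: "(\<Sum>C\<in>N. cut C) + ab X X \<le> k * p + 2 * k"
  proof -
    have "(\<Sum>C\<in>F. cut C) = (\<Sum>C\<in>I. cut C) + (\<Sum>C\<in>N. cut C)"
      unfolding FIN(1) using FIN(2) fin by (intro sum.union_disjoint)
    moreover have "(\<Sum>C\<in>I. k) \<le> (\<Sum>C\<in>I. cut C)" using Icut by (intro sum_mono) (auto simp: I_def)
    moreover have "k * card X \<le> k * (card I + p + 2)" using F_ge cF by (intro mult_left_mono) auto
    ultimately show ?thesis using sum_cuts by (simp add: algebra_simps)
  qed
  have sumN: "c * p \<le> (\<Sum>C\<in>N. cut C)" if "\<And>C. C \<in> N \<Longrightarrow> c \<le> cut C" for c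
  proof -
    have "(\<Sum>C\<in>N. c) \<le> (\<Sum>C\<in>N. cut C)" using that by (intro sum_mono)
    then show ?thesis by (simp add: p_def mult.commute)
  qed
  have "2 * k - 2 \<le> cut C" if "C \<in> N" for C
    using nontrivial_cut[OF k NF[OF that]] N3[OF that] by simp
  then have "(2 * k - 2) * p + ab X X \<le> k * p + 2 * k" using sumN bound by (meson add_le_mono1 le_trans)
  moreover have "2 * k - 2 = k + (k - 2)" using k by simp
  then have "(2 * k - 2) * p = k * p + (k - 2) * p" by (simp only: add_mult_distrib)
  ultimately have slack: "(k - 2) * p + ab X X \<le> 2 * k" by simp
  note expand = neighbourhood_expansion[OF k nonbip ev]
  have p2: "2 \<le> p"
  proof (cases "I0 = {}")
    case True
    then show ?thesis using cXI X_ge by simp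
  next
    case False
    then have "card I0 + 4 \<le> card (E `` I0)"
      using expand(1)[OF I0V] I0X XV X_sub by blast
    also have "\<dots> \<le> card X" using I0X finX by (intro card_mono)
    finally show ?thesis using cXI by simp
  qed
  \<comment> \<open>For \<open>p = 2\<close> the sets \<open>I0\<close>, unless empty, and
    \<open>I0 \<union> C1\<close> have excess exactly 4, hence even size, against odd
    \<open>card C1\<close>. The member \<open>C2\<close> keeps the second image different from
    \<open>V\<close>.\<close>
  have p3: "p \<noteq> 2" if k6: "6 \<le> k"
  proof
    assume "p = 2"
    then obtain C1 C2 where C: "N = {C1, C2}" "C1 \<noteq> C2" unfolding p_def by (meson card_2_iff)
    then have CF: "C1 \<in> F" "C2 \<in> F" using NF by auto
    have dis: "C1 \<inter> C2 = {}" using F_disjoint C(2) CF by (auto simp: disjoint_def)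
    have even_if: "even (card S)" if S: "S \<subseteq> V" "S \<noteq> {}" "E `` S \<noteq> V" "card (E `` S) \<le> card S + 4" for S
      using expand[OF S(1-3)] S(4) k6 by simp
    have cU: "card (I0 \<union> C1) = card I0 + card C1"
    proof (rule card_Un_disjoint)
      show "finite I0" using I0V finite_sub by blast
      show "finite C1" using F_sub[OF CF(1)] finite_sub by blast
      have "C \<inter> C1 = {}" if "C \<in> I" for C
      proof -
        have "C \<in> F" "C \<noteq> C1" using that C(1) FIN by auto
        then show ?thesis using F_disjoint CF(1) by (auto simp: disjoint_def)
      qed
      then show "I0 \<inter> C1 = {}" by (auto simp: I0_def)
    qed
    have "even (card I0)"
    proof (cases "I0 = {}")
      case False
      have "card (E `` I0) \<le> card X" using I0X finX by (intro card_mono)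
      then have "card (E `` I0) \<le> card I0 + 4" using cXI \<open>p = 2\<close> by simp
      moreover have "E `` I0 \<noteq> V" using I0X XV X_sub by blast
      ultimately show ?thesis using even_if[OF I0V False] by simp
    qed simp
    moreover have "even (card (I0 \<union> C1))"
    proof (rule even_if)
      have C1V: "C1 \<subseteq> V" "finite C1" using F_sub[OF CF(1)] finite_sub by auto
      show "I0 \<union> C1 \<subseteq> V" using I0V C1V by blast
      show "I0 \<union> C1 \<noteq> {}" using F_nonempty[OF CF(1)] by blast
      have sub: "E `` (I0 \<union> C1) \<subseteq> X \<union> C1" using I0X F_Image[OF CF(1)] by blast
      then show "E `` (I0 \<union> C1) \<noteq> V"
        using dis F_sub[OF CF(2)] F_nonempty[OF CF(2)] by blast
      have "card (E `` (I0 \<union> C1)) \<le> card (X \<union> C1)" using sub finX C1V by (intro card_mono) auto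
      also have "\<dots> \<le> card X + card C1" by (rule card_Un_le)
      also have "\<dots> \<le> card (I0 \<union> C1) + 4" using cXI cU \<open>p = 2\<close> by simp
      finally show "card (E `` (I0 \<union> C1)) \<le> card (I0 \<union> C1) + 4" .
    qed
    ultimately show False using F_odd[OF CF(1)] cU by simp
  qed
  \<comment> \<open>With \<open>p \<ge> 3\<close>, \<open>slack\<close> gives
    \<open>3 * (k - 2) \<le> 2 * k\<close>, which fails from \<open>k = 7\<close> on.\<close>
  have k56: "k = 5 \<or> k = 6"
  proof (rule ccontr)
    assume "\<not> ?thesis"
    then have k7: "7 \<le> k" using k by simp
    then have "3 \<le> p" using p2 p3 by simp
    then have "(k - 2) * 3 \<le> (k - 2) * p" by (intro mult_left_mono) auto
    then show False using slack k7 by linarith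
  qed
  \<comment> \<open>Cuts of at least 11 for \<open>k = 5\<close>, by parity, and 12 for
    \<open>k = 6\<close> would give \<open>6 * p \<le> 10\<close> and \<open>6 * p \<le> 12\<close>,
    against \<open>p \<ge> 2\<close> and \<open>p \<ge> 3\<close>.\<close>
  have tf: "\<not> triangle_free E"
  proof
    assume tf: "triangle_free E"
    have c: "2 * k \<le> cut C" if "C \<in> N" for C
      using triangle_free_nontrivial_cut[OF k56 NF[OF that] _ tf] N3[OF that] by simp
    show False
    proof (cases "k = 5")
      case True
      have "11 \<le> cut C" if C: "C \<in> N" for C
      proof -
        have "C \<subseteq> V" using F_sub[OF NF[OF C]] by blast
        then have "odd (cut C)" using cut_parity True F_odd[OF NF[OF C]] by simp
        then show ?thesis using c[OF C] True by (cases "cut C = 10") auto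
      qed
      then show ?thesis using sumN[of 11] bound True p2 by simp
    next
      case False
      then show ?thesis using sumN[OF c] bound k56 p2 p3 by auto
    qed
  qed
  have nine: "9 \<le> cut C" if k5: "k = 5" and C: "C \<in> N" for C
  proof -
    have "C \<subseteq> V" using F_sub[OF NF[OF C]] by blast
    then have "odd (cut C)" using cut_parity k5 F_odd[OF NF[OF C]] by simp
    moreover have "8 \<le> cut C" using nontrivial_cut[OF k NF[OF C]] N3[OF C] k5 by simp
    ultimately show ?thesis by (cases "cut C = 8") auto
  qed
  have slack5: "4 * p + ab X X \<le> 10" if k5: "k = 5"
    using sumN[OF nine[OF k5]] bound k5 by simp
  \<comment> \<open>\<open>4 * p\<close> is at most 10 for \<open>k = 5\<close> and at most 12 for
    \<open>k = 6\<close>; in the latter case no edge inside \<open>X\<close> remains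
    possible.\<close>
  have p_eq: "p = k - 3"
    using slack slack5 k56 p2 p3 by auto
  \<comment> \<open>Without singletons \<open>X\<close> has at most \<open>p + 2 = k - 1\<close>
    vertices, so passing to the closed neighbourhood adds at most \<open>k - 1\<close> vertices to a
    non-singleton \<open>C\<close>. That is too few for \<open>k = 6\<close>, and for
    \<open>k = 5\<close> it requires \<open>card C\<close> to be even.\<close>
  obtain v where v: "v \<in> I0"
  proof -
    have "I0 \<noteq> {}"
    proof
      assume e: "I0 = {}"
      have "N \<noteq> {}" using p2 by (auto simp: p_def)
      then obtain C where C: "C \<in> N" by blast
      have CV: "C \<subseteq> V" "C \<noteq> {}" "finite C"
        using F_sub[OF NF[OF C]] F_nonempty[OF NF[OF C]] finite_sub by auto
      have sub: "C \<union> E `` C \<subseteq> C \<union> X" using F_Image[OF NF[OF C]] by blast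
      have "card (N - {C}) \<noteq> 0" using p2 C fin by (simp add: p_def)
      then obtain C' where C': "C' \<in> N" "C' \<noteq> C" by (metis Diff_iff all_not_in_conv card.empty insertCI)
      have "C' \<inter> C = {}" using F_disjoint NF C C' by (auto simp: disjoint_def)
      then have "C' \<inter> (C \<union> X) = {}" using F_sub[OF NF[OF C'(1)]] by blast
      then have neV: "C \<union> E `` C \<noteq> V"
        using sub F_sub[OF NF[OF C'(1)]] F_nonempty[OF NF[OF C'(1)]] by blast
      have "card (C \<union> E `` C) \<le> card (C \<union> X)" using sub CV finX by (intro card_mono) auto
      also have "\<dots> \<le> card C + card X" by (rule card_Un_le)
      finally have "card (C \<union> E `` C) \<le> card C + (k - 1)" using cXI e p_eq k by simp
      then show False
        using closed_neighbourhood_expansion[OF k56 CV(1,2) neV] k56 F_odd[OF NF[OF C]] by auto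
    qed
    then show thesis using that by blast
  qed
  then have vV: "v \<in> V" and vX: "E `` {v} \<subseteq> X" using I0V I0X by auto
  have "ab (E `` {v}) (E `` {v}) \<le> ab X X" using vX by (intro ab_mono)
  moreover have t: "ab (E `` {u}) (E `` {u}) = ab (E `` {v}) (E `` {v})" if "u \<in> V" for u
    by (rule neighbourhood_arcs_const[OF that vV])
  moreover have tne: "ab (E `` {v}) (E `` {v}) \<noteq> 0" using triangle_freeI[OF vV] tf by blast
  ultimately have k5: "k = 5" and XX: "ab X X \<le> 2" "ab (E `` {v}) (E `` {v}) \<le> 2"
    using slack slack5 p_eq k56 by auto
  have p: "p = 2" using p_eq k5 by simp
  have tri: "\<exists>x y. (x, y) \<in> E \<and> x \<in> E `` {w} \<and> y \<in> E `` {w}" if "w \<in> V" for w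
  proof -
    have "E \<inter> E `` {w} \<times> E `` {w} \<noteq> {}" using t[OF that] tne by (auto simp: arcs_between_def)
    then show ?thesis by blast
  qed
  obtain x y where xy: "(x, y) \<in> E" "x \<in> E `` {v}" "y \<in> E `` {v}" using tri[OF vV] by blast
  have xyne: "x \<noteq> y" using xy(1) irrefl by (auto simp: irrefl_def)
  have xyX: "{(x, y), (y, x)} = E \<inter> X \<times> X"
    using xy vX symR xyne XX(1) finite_E
    by (intro card_seteq) (auto simp: arcs_between_def)
  \<comment> \<open>The triangle at a second singleton \<open>w\<close> would use the same edge
    \<open>xy\<close>, the only one inside \<open>X\<close>. Then \<open>x\<close> would lie in two
    triangles, whereas every vertex lies in exactly one.\<close>
  have "w = v" if w: "w \<in> I0" for w
  proof (rule ccontr)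
    assume ne: "w \<noteq> v"
    have "w \<in> V" "E `` {w} \<subseteq> X" using w I0V I0X by auto
    then obtain x' y' where "(x', y') \<in> E \<inter> X \<times> X" "x' \<in> E `` {w}" "y' \<in> E `` {w}" using tri by blast
    then have wxy: "x \<in> E `` {w}" "y \<in> E `` {w}" unfolding xyX[symmetric] by auto
    have "{(v, y), (y, v), (w, y), (y, w)} \<subseteq> E \<inter> E `` {x} \<times> E `` {x}"
      using xy wxy symR by auto
    then have "card {(v, y), (y, v), (w, y), (y, w)} \<le> ab (E `` {x}) (E `` {x})"
      unfolding arcs_between_def using finite_E by (intro card_mono) auto
    moreover have "v \<noteq> y" "w \<noteq> y" using xy wxy irrefl by (auto simp: irrefl_def)
    then have "card {(v, y), (y, v), (w, y), (y, w)} = 4" using ne by simp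
    moreover have "x \<in> V" using xy(1) R_sub by blast
    ultimately show False using t[of x] XX(2) by simp
  qed
  then have "I0 = {v}" using v by blast
  then have "card X \<le> 5" using cXI p by simp
  then have X: "X = E `` {v}" using vX finX regular[OF vV] k5 by (metis card_seteq)
  obtain C1 C2 where C: "N = {C1, C2}" "C1 \<noteq> C2" using p unfolding p_def by (meson card_2_iff)
  have "9 \<le> cut C1" "9 \<le> cut C2" using nine[OF k5] C by auto
  moreover have "cut C1 + cut C2 \<le> 20" using bound C k5 p by simp
  moreover have "12 \<le> cut C1 \<or> 12 \<le> cut C2"
    using neighbourhood_barrier_large_cut[OF k5 vV X _ _ C(2)] NF N3 C(1) by simp
  ultimately show False by linarith
qed

end

section \<open>Factor-criticality\<close>

lemma perfect_matching_induce_iff: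
  "perfect_matching (G \<restriction> W) M \<longleftrightarrow>
    M \<subseteq> {{u, v} |u v. (u, v) \<in> arcs_ends G \<and> u \<in> W \<and> v \<in> W} \<and> disjoint M \<and> \<Union> M = W"
proof -
  have "arcs_ends (G \<restriction> W) = arcs_ends G \<inter> W \<times> W"
    by (auto simp: arcs_ends_conv induce_subgraph_def)
  then show ?thesis by (auto simp: perfect_matching_def edges_def)
qed

lemma (in graph) card_neighbours: "card (arcs_ends G `` {v}) = out_degree G v"
proof -
  have "arcs_ends G `` {v} = head G ` out_arcs G v"
    by (auto simp: arcs_ends_conv out_arcs_def)
  moreover have "inj_on (head G) (out_arcs G v)"
    by (auto intro!: inj_onI no_multi_arcs simp: arc_to_ends_def)
  ultimately show ?thesis by (simp add: card_image out_degree_def)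
qed

lemma transitive_graph_arcs_ends:
  assumes "Digraph.graph G" "Digraph_Component.connected G" "vertex_transitive G" "regular_graph k G"
  shows "transitive_graph (verts G) (arcs_ends G) k"
proof -
  interpret graph G by fact
  show ?thesis
  proof
    show "finite (verts G)" by simp
    show "arcs_ends G \<subseteq> verts G \<times> verts G" by (auto simp: arcs_ends_conv)
    show "sym (arcs_ends G)" using sym_arcs by (simp add: symmetric_def)
    show "irrefl (arcs_ends G)" using adj_not_same by (auto simp: irrefl_def)
    show "card (arcs_ends G `` {v}) = k" if "v \<in> verts G" for v
      using assms(4) that by (simp add: card_neighbours regular_graph_def)
    fix x y assume "x \<in> verts G" "y \<in> verts G"
    then obtain h where "automorphism G h" "iso_verts h x = y"
      using assms(3) by (auto simp: vertex_transitive_def)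
    then show "\<exists>f. rel_automorphism (verts G) (arcs_ends G) f \<and> f x = y"
      using automorphism_on_verts_iff[OF assms(1), of "iso_verts h"]
      unfolding rel_automorphism_def by blast
  next
    fix S assume S: "S \<subseteq> verts G" "S \<noteq> {}" "arcs_ends G `` S \<subseteq> S"
    then obtain x where x: "x \<in> S" by blast
    have "strongly_connected G"
      using symmetric_connected_imp_strongly_connected[OF sym_arcs assms(2)] .
    have "y \<in> S" if y: "y \<in> verts G" for y
    proof -
      have "(x, y) \<in> rtrancl_on (verts G) (arcs_ends G)"
        using \<open>strongly_connected G\<close> x y S(1) by (auto simp: strongly_connected_def reachable_def)
      then have "(x, y) \<in> (arcs_ends G)\<^sup>*" by (rule rtrancl_on_rtranclI)
      then show "y \<in> S" using x S(3) by (metis Image_closed_trancl Image_singleton_iff rev_ImageI subsetD)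
    qed
    then show "S = verts G" using S(1) by blast
  qed
qed

text \<open>If the degree is at most 4, four vertices other than \<open>v\<close> can be chosen to
  include all its neighbours, and deleting them isolates \<open>v\<close>.\<close>

lemma factor_critical_imp_degree:
  assumes "Digraph.graph G" "regular_graph k G" "card (verts G) \<ge> 6" "factor_critical 4 G"
  shows "k \<ge> 5"
proof (rule ccontr)
  interpret graph G by fact
  assume "\<not> k \<ge> 5"
  then have k: "k \<le> 4" by simp
  obtain v where v: "v \<in> verts G" using assms(3) by fastforce
  let ?N = "arcs_ends G `` {v}"
  have N: "?N \<subseteq> verts G - {v}" using adj_not_same by (auto simp: arcs_ends_conv)
  have "card ?N \<le> 4" using assms(2) v k by (simp add: card_neighbours regular_graph_def)
  moreover have "4 \<le> card (verts G - {v})" using assms(3) v by simp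
  ultimately obtain S where S: "?N \<subseteq> S" "S \<subseteq> verts G - {v}" "card S = 4"
    using exists_subset_between[OF _ _ N] finite_Diff[OF finite_verts] by meson
  then obtain M where "perfect_matching (G \<restriction> (verts G - S)) M"
    using assms(4) unfolding factor_critical_def by blast
  then have M: "M \<subseteq> {{u, w} |u w. (u, w) \<in> arcs_ends G \<and> u \<in> verts G - S \<and> w \<in> verts G - S}"
    "\<Union> M = verts G - S"
    by (simp_all add: perfect_matching_induce_iff)
  have "v \<in> \<Union> M" using M(2) v S(2) by blast
  then obtain u w where uw: "v \<in> {u, w}" "(u, w) \<in> arcs_ends G" "u \<notin> S" "w \<notin> S" using M(1) by blast
  then have "(w, u) \<in> arcs_ends G" using arcs_ends_symmetric[OF sym_arcs] by blast
  then show False using uw S(1) by blast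
qed

lemma large_degree_imp_factor_critical:
  assumes "Digraph.graph G" "Digraph_Component.connected G" "vertex_transitive G"
    "\<not> bipartite_graph G" "regular_graph k G" "even (card (verts G))" "k \<ge> 5"
  shows "factor_critical 4 G"
proof -
  interpret transitive_graph "verts G" "arcs_ends G" k
    by (rule transitive_graph_arcs_ends) (use assms in auto)
  have "\<exists>M. perfect_matching (G \<restriction> (verts G - S)) M" if S: "S \<subseteq> verts G" "card S = 4" for S
  proof (rule ccontr)
    assume no: "\<nexists>M. perfect_matching (G \<restriction> (verts G - S)) M"
    let ?W = "verts G - S"
    have finS: "finite S" using S finite_sub by blast
    have finW: "finite ?W" using finite_V by simp
    have evW: "even (card ?W)" using assms(6) S finS by (simp add: card_Diff_subset)
    obtain Y0 F0 where b0: "odd_barrier (arcs_ends G) ?W Y0 F0" "card F0 > card Y0"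
      using tutte[OF finW R_sym irrefl evW] no by (auto simp: perfect_matching_induce_iff)
    obtain F where b: "odd_barrier (arcs_ends G) ?W Y0 F" "card F \<ge> card Y0 + 2"
      by (rule odd_barrier_parity[OF b0(1) R_sym finW b0(2) evW])
    have Y0: "Y0 \<subseteq> ?W" "finite Y0" using b(1) finW finite_subset by (auto simp: odd_barrier_def)
    have cX: "card (S \<union> Y0) = 4 + card Y0"
      using Y0 S finS by (subst card_Un_disjoint) auto
    \<comment> \<open>Joined to the Tutte set, the four removed vertices leave a barrier of the
      whole graph with the same odd members.\<close>
    have "odd_barrier (arcs_ends G) (verts G) (S \<union> Y0) F"
      using b(1) S(1) unfolding odd_barrier_def by blast
    then interpret graph_barrier "verts G" "arcs_ends G" k "S \<union> Y0" F
      by unfold_locales (use cX b(2) in auto)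
    show False
      by (rule no_barrier) (use assms in \<open>auto simp: bipartite_graph_def\<close>)
  qed
  then show ?thesis using assms(6) by (auto simp: factor_critical_def)
qed

theorem theorem1p2:
  fixes G :: "('a, 'b) pre_digraph" and k :: nat
  assumes "Digraph.graph G"
    and "Digraph_Component.connected G"
    and "vertex_transitive G"
    and "\<not> bipartite_graph G"
    and "regular_graph k G"
    and "even (card (verts G))"
    and "card (verts G) \<ge> 6"
  shows "factor_critical 4 G \<longleftrightarrow> k \<ge> 5"
  using factor_critical_imp_degree[OF assms(1,5,7)] large_degree_imp_factor_critical[OF assms(1-6)] by blast

end
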